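(* Assume that $\mathbf{G}$ satisfies (A1), (A2), (A3) and (A4), and that $\mathbf{u}_0\in L^2(\Omega;\mathbb{V}\cap \mathbf{H}^2(D))$. Let $(\mathbf{u},P)$ be the velocity and time-averaged pressure of the stochastic Stokes equations with initial value $\mathbf{u}_0$, let $\{p^n\}_{n=1}^M$ be the pressure approximations generated by Algorithm 1 with time step $k=T/M$ and $\mathbf{u}^0=\mathbf{u}_0$, and put $$\tilde p(t_n)=\frac{P(t_n)-P(t_{n-1})}{k},\qquad 1\le n\le M.$$ Then for every $\epsilon>0$ there exists a constant $C=C(\mathbf{u}_0,D_T)>0$, independent of $k$, such that $$\mathbb{E}\Bigl[k\sum_{n=1}^M\|\tilde p(t_n)-p^n\|_{L^2}\Bigr]\le C\,k^{1-\epsilon}.$$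
   Context: Setting. $D=(0,L)^d\subset\mathbb{R}^d$ ($d=2,3$) is a period cell, $T>0$, $D_T=(0,T)\times D$. $(\Omega,\mathcal{F},\{\mathcal{F}_t\},\mathbb{P})$ is a filtered probability space, $\mathbb{E}$ denotes expectation, and $W$ is an $\mathbb{R}$-valued $\{\mathcal{F}_t\}$-Wiener process. $\mathbf{L}^p_{per}(D)$, $\mathbf{H}^m_{per}(D)$ are the Lebesgue/Sobolev spaces of $\mathbb{R}^d$-valued functions that are $D$-periodic with vanishing mean (non-bold: scalar versions); $(\cdot,\cdot)$ is the $L^2(D)$-inner product. $\mathbb{H}=\{\mathbf{v}\in\mathbf{L}^2_{per}(D):\operatorname{div}\mathbf{v}=0\text{ weakly}\}$, $\mathbb{V}=\{\mathbf{v}\in\mathbf{H}^1_{per}(D):\operatorname{div}\mathbf{v}=0\text{ weakly}\}$. The viscosity is $\nu=1$ and the body force is $\mathbf{f}=0$. $L^2(\Omega;X)$ is the Bochner space of $X$-valued random variables $v$ with $\mathbb{E}\|v\|_X^2<\infty$. Assumptions on the map $\mathbf{G}:\mathcal{H}\to\mathcal{K}$, where the pair $(\mathcal{H},\mathcal{K})$ ranges over $(\mathbf{L}^2_{per},\mathbf{L}^2_{per})$, $(\mathbf{H}^1_{per},\mathbf{H}^1_{per})$, $(\mathbf{H}^2_{per},\mathbf{H}^2_{per})$; $D\mathbf{G}$, $D^2\mathbf{G}$ are the first and second Gateaux derivatives, $\mathcal{L}(\mathcal{H},\mathcal{K})$ is the space of linear maps and $\mathcal{L}_2(\mathcal{H},\mathcal{K})=\mathcal{L}(\mathcal{H},\mathcal{L}(\mathcal{H},\mathcal{K}))$: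 (A1) there is $C>0$ with $\|\mathbf{G}(\mathbf{v})-\mathbf{G}(\mathbf{w})\|_{\mathcal{K}}\le C\|\mathbf{v}-\mathbf{w}\|_{\mathcal{H}}$ and $\|\mathbf{G}(\mathbf{v})\|_{\mathcal{K}}\le C(\|\mathbf{v}\|_{\mathcal{H}}+1)$ for all $\mathbf{v},\mathbf{w}\in\mathcal{H}$. (A2) there is $C>0$ with $\|D\mathbf{G}\|_{L^\infty(\mathcal{H};\mathcal{L}(\mathcal{H},\mathcal{K}))}+\|D^2\mathbf{G}\|_{L^\infty(\mathcal{H};\mathcal{L}_2(\mathcal{H},\mathcal{K}))}\le C$. (A3) there is $C>0$ with $\|(D\mathbf{G}(\mathbf{u})-D\mathbf{G}(\mathbf{v}))\mathbf{G}(\mathbf{v})\|_{\mathbf{L}^2}\le C\|\mathbf{u}-\mathbf{v}\|_{\mathbf{L}^2}$ for all $\mathbf{u},\mathbf{v}\in\mathbf{L}^2_{per}(D)$. (A4) $\mathbf{G}$ maps $\mathbf{H}^1_{per}(D)$ into $\mathbb{V}$, i.e. $\operatorname{div}\mathbf{G}(\mathbf{u})=0$ for each $\mathbf{u}\in\mathbf{H}^1_{per}(D)$. Variational solution. An $\{\mathcal{F}_t\}$-adapted process $\mathbf{u}\in L^2(\Omega;C([0,T];\mathbb{V}))\cap L^2(\Omega;L^2(0,T;\mathbf{H}^2_{per}(D)))$ such that $\mathbb{P}$-a.s. for all $t\in(0,T]$ and all $\mathbf{v}\in\mathbb{V}$, $$(\mathbf{u}(t),\mathbf{v})+\int_0^t(\nabla\mathbf{u}(s),\nabla\mathbf{v})\,ds=(\mathbf{u}_0,\mathbf{v})+\Bigl(\int_0^t\mathbf{G}(\mathbf{u}(s))\,dW(s),\mathbf{v}\Bigr).$$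 Time-averaged pressure (known existence result). There is a unique adapted process $P\in L^2(\Omega;L^2(0,T;H^1_{per}(D)/\mathbb{R}))$ such that $\mathbb{P}$-a.s. for all $t\in(0,T]$ and all $\boldsymbol{\phi}\in\mathbf{H}^1_{per}(D)$, $$(\mathbf{u}(t),\boldsymbol{\phi})+\int_0^t(\nabla\mathbf{u}(s),\nabla\boldsymbol{\phi})\,ds-(\operatorname{div}\boldsymbol{\phi},P(t))=(\mathbf{u}_0,\boldsymbol{\phi})+\Bigl(\int_0^t\mathbf{G}(\mathbf{u}(s))\,dW(s),\boldsymbol{\phi}\Bigr),$$ and $(\operatorname{div}\mathbf{u}(t),q)=0$ for all $q\in L^2_{per}(D)/\mathbb{R}$; moreover $P(0)=0$. Algorithm 1. Let $k=T/M$, $t_n=nk$ ($0\le n\le M$), $\Delta W_n=W(t_{n+1})-W(t_n)$, $\mathbf{u}^0=\mathbf{u}_0$. For $n=0,\dots,M-1$ find $(\mathbf{u}^{n+1},p^{n+1})\in\mathbb{V}\times L^2_{per}(D)/\mathbb{R}$ such that $\mathbb{P}$-a.s., for all $\boldsymbol{\phi}\in\mathbf{H}^1_{per}(D)$ and $\psi\in L^2_{per}(D)$, $$(\mathbf{u}^{n+1}-\mathbf{u}^n,\boldsymbol{\phi})+k(\nabla\mathbf{u}^{n+1},\nabla\boldsymbol{\phi})-k(p^{n+1},\operatorname{div}\boldsymbol{\phi})=\Bigl(\mathbf{G}(\mathbf{u}^n)\Delta W_n+\tfrac12 D\mathbf{G}(\mathbf{u}^n)\mathbf{G}(\mathbf{u}^n)\bigl[(\Delta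 W_n)^2-k\bigr],\boldsymbol{\phi}\Bigr),$$ $$(\operatorname{div}\mathbf{u}^{n+1},\psi)=0.$$ *)

theory Defs
  imports
    "HOL-Probability.Probability"
    "HOL-Library.Function_Algebras"
begin

text \<open>
  Elements of the Lebesgue and Sobolev spaces are represented by functions rather than by
  equivalence classes: every norm, inner product and equation below depends only on the
  class modulo Lebesgue null sets, and equality in a space means that the norm of the
  difference is zero. Function types get their pointwise vector space structure.
\<close>

instantiation "fun" :: (type, real_vector) real_vector
begin

definition scaleR_fun :: "real \<Rightarrow> ('a \<Rightarrow> 'b) \<Rightarrow> 'a \<Rightarrow> 'b"
  where "scaleR_fun c f = (\<lambda>x. c *\<^sub>R f x)"

instance
  by standard (auto simp: scaleR_fun_def fun_eq_iff algebra_simps)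

end


section \<open>Lebesgue and Sobolev spaces\<close>

definition pd :: "'d::finite \<Rightarrow> (real^'d \<Rightarrow> real) \<Rightarrow> real^'d \<Rightarrow> real"
  where "pd i \<phi> x = frechet_derivative \<phi> (at x) (axis i 1)"

primrec Ck :: "nat \<Rightarrow> (real^'d::finite \<Rightarrow> real) \<Rightarrow> bool"
where
  "Ck 0 \<phi> \<longleftrightarrow> continuous_on UNIV \<phi>"
| "Ck (Suc m) \<phi> \<longleftrightarrow> \<phi> differentiable_on UNIV \<and> (\<forall>i. Ck m (pd i \<phi>))"

definition smooth :: "(real^'d::finite \<Rightarrow> real) \<Rightarrow> bool"
  where "smooth \<phi> \<longleftrightarrow> (\<forall>m. Ck m \<phi>)"

definition cell :: "real \<Rightarrow> (real^'d::finite) set"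
  where "cell L = box 0 (\<chi> i. L)"

definition periodic :: "real \<Rightarrow> (real^'d::finite \<Rightarrow> 'b) \<Rightarrow> bool"
  where "periodic L f \<longleftrightarrow> (\<forall>x i. f (x + L *\<^sub>R axis i 1) = f x)"

definition test_per :: "real \<Rightarrow> (real^'d::finite \<Rightarrow> real) set"
  where "test_per L = {\<phi>. smooth \<phi> \<and> periodic L \<phi>}"

definition test_cpt :: "(real^'d::finite) set \<Rightarrow> (real^'d \<Rightarrow> real) set"
  where "test_cpt D =
    {\<phi>. smooth \<phi> \<and> compact (closure {x. \<phi> x \<noteq> 0}) \<and> closure {x. \<phi> x \<noteq> 0} \<subseteq> D}"

definition ip :: "(real^'d::finite) set \<Rightarrow> (real^'d \<Rightarrow> 'b::euclidean_space) \<Rightarrow> (real^'d \<Rightarrow> 'b) \<Rightarrow> real"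
  where "ip D f g = (LINT x:D|lborel. f x \<bullet> g x)"

definition L2norm :: "(real^'d::finite) set \<Rightarrow> (real^'d \<Rightarrow> 'b::euclidean_space) \<Rightarrow> real"
  where "L2norm D f = sqrt (ip D f f)"

definition L2 :: "(real^'d::finite) set \<Rightarrow> (real^'d \<Rightarrow> 'b::euclidean_space) set"
  where "L2 D = {f \<in> borel_measurable borel. set_integrable lborel D (\<lambda>x. (norm (f x))\<^sup>2)}"

definition L2per :: "real \<Rightarrow> (real^'d::finite \<Rightarrow> 'b::euclidean_space) set"
  where "L2per L = {f \<in> L2 (cell L). periodic L f \<and> (LINT x:cell L|lborel. f x) = 0}"

text \<open>
  The Sobolev notions are parametrised by the domain \<open>D\<close>, the class \<open>S\<close> of test functions and
  the space \<open>Y\<close> of square integrable functions in which the weak derivatives are sought.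
  They are used with \<open>(cell L, test_per L, L2per L)\<close> for the periodic spaces
  (distributional derivatives on the torus) and with \<open>(D, test_cpt D, L2 D)\<close> for the usual
  Sobolev spaces on an open set \<open>D\<close>.
\<close>

definition weak_pd ::
  "(real^'d::finite) set \<Rightarrow> (real^'d \<Rightarrow> real) set \<Rightarrow> 'd \<Rightarrow>
   (real^'d \<Rightarrow> 'b::euclidean_space) \<Rightarrow> (real^'d \<Rightarrow> 'b) \<Rightarrow> bool"
  where "weak_pd D S i f g \<longleftrightarrow>
    (\<forall>\<phi>\<in>S. (LINT x:D|lborel. pd i \<phi> x *\<^sub>R f x) = - (LINT x:D|lborel. \<phi> x *\<^sub>R g x))"

definition wderiv ::
  "(real^'d::finite) set \<Rightarrow> (real^'d \<Rightarrow> real) set \<Rightarrow> (real^'d \<Rightarrow> 'b::euclidean_space) set \<Rightarrow> 'd \<Rightarrow>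
   (real^'d \<Rightarrow> 'b) \<Rightarrow> real^'d \<Rightarrow> 'b"
  where "wderiv D S Y i f = (SOME g. g \<in> Y \<and> weak_pd D S i f g)"

primrec sob ::
  "(real^'d::finite) set \<Rightarrow> (real^'d \<Rightarrow> real) set \<Rightarrow> (real^'d \<Rightarrow> 'b::euclidean_space) set \<Rightarrow> nat \<Rightarrow>
   (real^'d \<Rightarrow> 'b) set"
where
  "sob D S Y 0 = Y"
| "sob D S Y (Suc m) = {f \<in> Y. \<forall>i. \<exists>g\<in>sob D S Y m. weak_pd D S i f g}"

primrec sobnorm ::
  "(real^'d::finite) set \<Rightarrow> (real^'d \<Rightarrow> real) set \<Rightarrow> (real^'d \<Rightarrow> 'b::euclidean_space) set \<Rightarrow> nat \<Rightarrow>
   (real^'d \<Rightarrow> 'b) \<Rightarrow> real"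
where
  "sobnorm D S Y 0 f = L2norm D f"
| "sobnorm D S Y (Suc m) f =
    sqrt ((L2norm D f)\<^sup>2 + (\<Sum>i\<in>UNIV. (sobnorm D S Y m (wderiv D S Y i f))\<^sup>2))"

definition Hper :: "real \<Rightarrow> nat \<Rightarrow> (real^'d::finite \<Rightarrow> 'b::euclidean_space) set"
  where "Hper L m = sob (cell L) (test_per L) (L2per L) m"

definition Hnorm :: "real \<Rightarrow> nat \<Rightarrow> (real^'d::finite \<Rightarrow> 'b::euclidean_space) \<Rightarrow> real"
  where "Hnorm L m f = sobnorm (cell L) (test_per L) (L2per L) m f"

definition Hdom :: "(real^'d::finite) set \<Rightarrow> nat \<Rightarrow> (real^'d \<Rightarrow> 'b::euclidean_space) set"
  where "Hdom D m = sob D (test_cpt D) (L2 D) m"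

definition Hdom_norm :: "(real^'d::finite) set \<Rightarrow> nat \<Rightarrow> (real^'d \<Rightarrow> 'b::euclidean_space) \<Rightarrow> real"
  where "Hdom_norm D m f = sobnorm D (test_cpt D) (L2 D) m f"

definition dper :: "real \<Rightarrow> 'd::finite \<Rightarrow> (real^'d \<Rightarrow> 'b::euclidean_space) \<Rightarrow> real^'d \<Rightarrow> 'b"
  where "dper L i f = wderiv (cell L) (test_per L) (L2per L) i f"

definition grad_ip :: "real \<Rightarrow> (real^'d::finite \<Rightarrow> 'b::euclidean_space) \<Rightarrow> (real^'d \<Rightarrow> 'b) \<Rightarrow> real"
  where "grad_ip L v w = (\<Sum>i\<in>UNIV. ip (cell L) (dper L i v) (dper L i w))"

definition dvg :: "real \<Rightarrow> (real^'d::finite \<Rightarrow> real^'d) \<Rightarrow> real^'d \<Rightarrow> real"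
  where "dvg L v x = (\<Sum>i\<in>UNIV. dper L i v x $ i)"

definition weakly_div_free :: "real \<Rightarrow> (real^'d::finite \<Rightarrow> real^'d) \<Rightarrow> bool"
  where "weakly_div_free L v \<longleftrightarrow> (\<forall>q\<in>test_per L. ip (cell L) v (\<lambda>x. \<chi> i. pd i q x) = 0)"

definition V :: "real \<Rightarrow> (real^'d::finite \<Rightarrow> real^'d) set"
  where "V L = {v \<in> Hper L 1. weakly_div_free L v}"


section \<open>Random variables and processes with values in function spaces\<close>

text \<open>
  Strong (Bochner) measurability of a map into the space \<open>X\<close> with norm \<open>nrm\<close>: it is a limit of
  simple functions. The approximants are measurable with respect to \<open>F\<close>, whereas the
  exceptional null set is taken in \<open>N\<close>, so that \<open>F\<close> need not contain the null sets of \<open>N\<close>.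
\<close>

definition strongly_measurable ::
  "'w measure \<Rightarrow> 'w measure \<Rightarrow> 'b::real_vector set \<Rightarrow> ('b \<Rightarrow> real) \<Rightarrow> ('w \<Rightarrow> 'b) \<Rightarrow> bool"
  where "strongly_measurable N F X nrm f \<longleftrightarrow>
    (AE w in N. f w \<in> X) \<and>
    (\<exists>s. (\<forall>n. simple_function F (s n) \<and> s n ` space F \<subseteq> X) \<and>
         (AE w in N. (\<lambda>n::nat. nrm (s n w - f w)) \<longlonglongrightarrow> 0))"

definition sq_norm_integral :: "'w measure \<Rightarrow> ('b::real_vector \<Rightarrow> real) \<Rightarrow> ('w \<Rightarrow> 'b) \<Rightarrow> ennreal"
  where "sq_norm_integral N nrm f = (\<integral>\<^sup>+w. ennreal ((nrm (f w))\<^sup>2) \<partial>N)"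

definition bochner_L2 :: "'w measure \<Rightarrow> 'b::real_vector set \<Rightarrow> ('b \<Rightarrow> real) \<Rightarrow> ('w \<Rightarrow> 'b) set"
  where "bochner_L2 N X nrm =
    {f. strongly_measurable N N X nrm f \<and> sq_norm_integral N nrm f < \<infinity>}"

definition bochner_L2_norm :: "'w measure \<Rightarrow> ('b::real_vector \<Rightarrow> real) \<Rightarrow> ('w \<Rightarrow> 'b) \<Rightarrow> real"
  where "bochner_L2_norm N nrm f = sqrt (enn2real (sq_norm_integral N nrm f))"

definition time :: "real \<Rightarrow> real measure"
  where "time T = restrict_space lborel {0..T}"

definition C_space :: "real \<Rightarrow> 'b::real_vector set \<Rightarrow> ('b \<Rightarrow> real) \<Rightarrow> (real \<Rightarrow> 'b) set"
  where "C_space T X nrm =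
    {v. \<forall>t\<in>{0..T}. v t \<in> X \<and> ((\<lambda>s. nrm (v s - v t)) \<longlongrightarrow> 0) (at t within {0..T})}"

definition C_norm :: "real \<Rightarrow> ('b::real_vector \<Rightarrow> real) \<Rightarrow> (real \<Rightarrow> 'b) \<Rightarrow> real"
  where "C_norm T nrm v = (SUP t\<in>{0..T}. nrm (v t))"

definition adapted ::
  "'w measure \<Rightarrow> (real \<Rightarrow> 'w measure) \<Rightarrow> real \<Rightarrow> 'b::real_vector set \<Rightarrow> ('b \<Rightarrow> real) \<Rightarrow>
   (real \<Rightarrow> 'w \<Rightarrow> 'b) \<Rightarrow> bool"
  where "adapted M F T X nrm Y \<longleftrightarrow> (\<forall>t\<in>{0..T}. strongly_measurable M (F t) X nrm (Y t))"

definition filtered_prob_space :: "'w measure \<Rightarrow> (real \<Rightarrow> 'w measure) \<Rightarrow> bool"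
  where "filtered_prob_space M F \<longleftrightarrow>
    prob_space M \<and> (\<forall>t\<ge>0. subalgebra M (F t)) \<and> (\<forall>s\<ge>0. \<forall>t\<ge>s. subalgebra (F t) (F s))"

definition wiener_process :: "'w measure \<Rightarrow> (real \<Rightarrow> 'w measure) \<Rightarrow> (real \<Rightarrow> 'w \<Rightarrow> real) \<Rightarrow> bool"
  where "wiener_process M F W \<longleftrightarrow>
    (AE w in M. W 0 w = 0) \<and>
    (\<forall>t\<ge>0. W t \<in> borel_measurable (F t)) \<and>
    (\<forall>s\<ge>0. \<forall>t>s.
       prob_space.indep_set M (sets (F s))
         {(\<lambda>w. W t w - W s w) -` A \<inter> space M |A. A \<in> sets borel} \<and>
       distributed M lborel (\<lambda>w. W t w - W s w) (normal_density 0 (sqrt (t - s)))) \<and>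
    (AE w in M. continuous_on {0..} (\<lambda>t. W t w))"


section \<open>The stochastic integral\<close>

text \<open>
  The elementary process with jump times \<open>\<tau> 0 \<le> \<dots> \<le> \<tau> m\<close> takes the value \<open>\<xi> i\<close>, a simple
  random variable known at time \<open>\<tau> i\<close>, on the interval from \<open>\<tau> i\<close> (excluded) to \<open>\<tau> (i + 1)\<close>.
\<close>

definition elementary ::
  "(real \<Rightarrow> 'w measure) \<Rightarrow> 'b set \<Rightarrow> real \<Rightarrow> nat \<Rightarrow> (nat \<Rightarrow> real) \<Rightarrow> (nat \<Rightarrow> 'w \<Rightarrow> 'b) \<Rightarrow> bool"
  where "elementary F X t m \<tau> \<xi> \<longleftrightarrow>
    0 \<le> \<tau> 0 \<and> \<tau> m \<le> t \<and>
    (\<forall>i<m. \<tau> i \<le> \<tau> (Suc i) \<and>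
       simple_function (F (\<tau> i)) (\<xi> i) \<and> \<xi> i ` space (F (\<tau> i)) \<subseteq> X)"

definition elementary_process ::
  "nat \<Rightarrow> (nat \<Rightarrow> real) \<Rightarrow> (nat \<Rightarrow> 'w \<Rightarrow> 'b::real_vector) \<Rightarrow> real \<Rightarrow> 'w \<Rightarrow> 'b"
  where "elementary_process m \<tau> \<xi> s w =
    (\<Sum>i<m. indicator {\<tau> i<..\<tau> (Suc i)} s *\<^sub>R \<xi> i w)"

definition elementary_integral ::
  "(real \<Rightarrow> 'w \<Rightarrow> real) \<Rightarrow> nat \<Rightarrow> (nat \<Rightarrow> real) \<Rightarrow> (nat \<Rightarrow> 'w \<Rightarrow> 'b::real_vector) \<Rightarrow> 'w \<Rightarrow> 'b"
  where "elementary_integral W m \<tau> \<xi> w =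
    (\<Sum>i<m. (W (\<tau> (Suc i)) w - W (\<tau> i) w) *\<^sub>R \<xi> i w)"

text \<open>\<open>I\<close> is (a version of) the Ito integral of \<open>\<Phi>\<close> with respect to \<open>W\<close> over \<open>[0, t]\<close>.\<close>

definition ito_integral_at ::
  "'w measure \<Rightarrow> (real \<Rightarrow> 'w measure) \<Rightarrow> (real \<Rightarrow> 'w \<Rightarrow> real) \<Rightarrow> 'b::real_vector set \<Rightarrow>
   ('b \<Rightarrow> real) \<Rightarrow> real \<Rightarrow> (real \<Rightarrow> 'w \<Rightarrow> 'b) \<Rightarrow> ('w \<Rightarrow> 'b) \<Rightarrow> bool"
  where "ito_integral_at M F W X nrm t \<Phi> I \<longleftrightarrow>
    (\<lambda>(s, w). \<Phi> s w) \<in> bochner_L2 (time t \<Otimes>\<^sub>M M) X nrm \<and>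
    I \<in> bochner_L2 M X nrm \<and>
    (\<exists>m \<tau> \<xi>. (\<forall>n::nat. elementary F X t (m n) (\<tau> n) (\<xi> n)) \<and>
       (\<lambda>n. sq_norm_integral (time t \<Otimes>\<^sub>M M) nrm
              (\<lambda>(s, w). elementary_process (m n) (\<tau> n) (\<xi> n) s w - \<Phi> s w)) \<longlonglongrightarrow> 0 \<and>
       (\<lambda>n. sq_norm_integral M nrm
              (\<lambda>w. elementary_integral W (m n) (\<tau> n) (\<xi> n) w - I w)) \<longlonglongrightarrow> 0)"

text \<open>The Ito integral as a process, in its version with continuous paths.\<close>

definition ito_integral ::
  "'w measure \<Rightarrow> (real \<Rightarrow> 'w measure) \<Rightarrow> (real \<Rightarrow> 'w \<Rightarrow> real) \<Rightarrow> 'b::real_vector set \<Rightarrow>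
   ('b \<Rightarrow> real) \<Rightarrow> real \<Rightarrow> (real \<Rightarrow> 'w \<Rightarrow> 'b) \<Rightarrow> (real \<Rightarrow> 'w \<Rightarrow> 'b) \<Rightarrow> bool"
  where "ito_integral M F W X nrm T \<Phi> J \<longleftrightarrow>
    (\<forall>t\<in>{0..T}. ito_integral_at M F W X nrm t \<Phi> (J t)) \<and>
    (AE w in M. (\<lambda>t. J t w) \<in> C_space T X nrm)"


section \<open>The noise coefficient\<close>

text \<open>
  Linear maps from \<open>X\<close> (with norm \<open>NX\<close>) to \<open>Y\<close> (with norm \<open>NY\<close>); the norms are
  \<open>ennreal\<close>-valued so that an operator norm is again such a norm.
\<close>

definition lin_maps ::
  "'a::real_vector set \<Rightarrow> 'b::real_vector set \<Rightarrow> ('b \<Rightarrow> ennreal) \<Rightarrow> ('a \<Rightarrow> 'b) set"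
  where "lin_maps X Y NY =
    {A. (\<forall>x\<in>X. A x \<in> Y) \<and>
        (\<forall>x\<in>X. \<forall>y\<in>X. NY (A (x + y) - (A x + A y)) = 0) \<and>
        (\<forall>c. \<forall>x\<in>X. NY (A (c *\<^sub>R x) - c *\<^sub>R A x) = 0)}"

definition op_norm :: "'a set \<Rightarrow> ('a \<Rightarrow> ennreal) \<Rightarrow> ('b \<Rightarrow> ennreal) \<Rightarrow> ('a \<Rightarrow> 'b) \<Rightarrow> ennreal"
  where "op_norm X NX NY A = (SUP x\<in>{x \<in> X. NX x \<le> 1}. NY (A x))"

definition gateaux_deriv ::
  "'a::real_vector set \<Rightarrow> ('b::real_vector \<Rightarrow> ennreal) \<Rightarrow> ('a \<Rightarrow> 'b) \<Rightarrow> 'a \<Rightarrow> ('a \<Rightarrow> 'b) \<Rightarrow> bool"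
  where "gateaux_deriv X NY g u A \<longleftrightarrow>
    (\<forall>v\<in>X. ((\<lambda>h::real. NY ((1 / h) *\<^sub>R (g (u + h *\<^sub>R v) - g u) - A v)) \<longlongrightarrow> 0) (at 0))"

type_synonym 'd field_map = "(real^'d \<Rightarrow> real^'d) \<Rightarrow> (real^'d \<Rightarrow> real^'d)"

text \<open>
  The indices \<open>m = 0, 1, 2\<close> stand for the three pairs of spaces; \<open>DG u v\<close> is the first
  Gateaux derivative at \<open>u\<close> in direction \<open>v\<close>, and \<open>D2G u w v\<close> that of \<open>\<lambda>u. DG u v\<close> in
  direction \<open>w\<close>. A derivative for one pair is also one for the pairs with smaller index on
  the common domain, so one \<open>DG\<close> serves all three.
\<close>

definition A1 :: "real \<Rightarrow> ('d::finite) field_map \<Rightarrow> bool"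
  where "A1 L G \<longleftrightarrow>
    (\<forall>m\<in>{0, 1, 2}. \<exists>C>0.
       (\<forall>v\<in>Hper L m. \<forall>w\<in>Hper L m. Hnorm L m (G v - G w) \<le> C * Hnorm L m (v - w)) \<and>
       (\<forall>v\<in>Hper L m. Hnorm L m (G v) \<le> C * (Hnorm L m v + 1)))"

definition A2 ::
  "real \<Rightarrow> ('d::finite) field_map \<Rightarrow> ((real^'d \<Rightarrow> real^'d) \<Rightarrow> 'd field_map) \<Rightarrow>
   ((real^'d \<Rightarrow> real^'d) \<Rightarrow> (real^'d \<Rightarrow> real^'d) \<Rightarrow> 'd field_map) \<Rightarrow> bool"
  where "A2 L G DG D2G \<longleftrightarrow>
    (\<forall>m\<in>{0, 1, 2}. \<exists>C>0.
       (let X = Hper L m; N = (\<lambda>v. ennreal (Hnorm L m v)); N1 = op_norm X N N in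
          (\<forall>u\<in>X. DG u \<in> lin_maps X X N \<and> gateaux_deriv X N G u (DG u)) \<and>
          (\<forall>u\<in>X. D2G u \<in> lin_maps X (lin_maps X X N) N1 \<and> gateaux_deriv X N1 DG u (D2G u)) \<and>
          (SUP u\<in>X. N1 (DG u)) + (SUP u\<in>X. op_norm X N N1 (D2G u)) \<le> ennreal C))"

definition A3 ::
  "real \<Rightarrow> ('d::finite) field_map \<Rightarrow> ((real^'d \<Rightarrow> real^'d) \<Rightarrow> 'd field_map) \<Rightarrow> bool"
  where "A3 L G DG \<longleftrightarrow>
    (\<exists>C>0. \<forall>u\<in>L2per L. \<forall>v\<in>L2per L.
       L2norm (cell L) ((DG u - DG v) (G v)) \<le> C * L2norm (cell L) (u - v))"

definition A4 :: "real \<Rightarrow> ('d::finite) field_map \<Rightarrow> bool"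
  where "A4 L G \<longleftrightarrow> (\<forall>u\<in>Hper L 1. G u \<in> V L)"


section \<open>The stochastic Stokes equations and their time discretisation\<close>

definition stokes_velocity ::
  "'w measure \<Rightarrow> (real \<Rightarrow> 'w measure) \<Rightarrow> (real \<Rightarrow> 'w \<Rightarrow> real) \<Rightarrow> real \<Rightarrow> real \<Rightarrow>
   ('d::finite) field_map \<Rightarrow> ('w \<Rightarrow> real^'d \<Rightarrow> real^'d) \<Rightarrow>
   (real \<Rightarrow> 'w \<Rightarrow> real^'d \<Rightarrow> real^'d) \<Rightarrow> bool"
  where "stokes_velocity M F W T L G u0 u \<longleftrightarrow>
    adapted M F T (V L) (Hnorm L 1) u \<and>
    (\<lambda>w t. u t w) \<in> bochner_L2 M (C_space T (V L) (Hnorm L 1)) (C_norm T (Hnorm L 1)) \<and>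
    (\<lambda>w t. u t w) \<in> bochner_L2 M (bochner_L2 (time T) (Hper L 2) (Hnorm L 2))
                      (bochner_L2_norm (time T) (Hnorm L 2)) \<and>
    (\<exists>J. ito_integral M F W (L2per L) (L2norm (cell L)) T (\<lambda>s w. G (u s w)) J \<and>
       (AE w in M. \<forall>t\<in>{0<..T}. \<forall>v\<in>V L.
          ip (cell L) (u t w) v + (LINT s:{0..t}|lborel. grad_ip L (u s w) v) =
          ip (cell L) (u0 w) v + ip (cell L) (J t w) v))"

text \<open>
  Scalar functions modulo constants are represented by their mean-free representative, so
  that the quotient norm is the \<open>L\<^sup>2\<close> norm. The pressure is required to lie in \<open>H\<^sup>1\<close> for almost
  every time and, so that the equation makes sense, in \<open>L\<^sup>2\<close> for every time.
\<close>

definition stokes_pressure ::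
  "'w measure \<Rightarrow> (real \<Rightarrow> 'w measure) \<Rightarrow> (real \<Rightarrow> 'w \<Rightarrow> real) \<Rightarrow> real \<Rightarrow> real \<Rightarrow>
   ('d::finite) field_map \<Rightarrow> ('w \<Rightarrow> real^'d \<Rightarrow> real^'d) \<Rightarrow>
   (real \<Rightarrow> 'w \<Rightarrow> real^'d \<Rightarrow> real^'d) \<Rightarrow> (real \<Rightarrow> 'w \<Rightarrow> real^'d \<Rightarrow> real) \<Rightarrow> bool"
  where "stokes_pressure M F W T L G u0 u P \<longleftrightarrow>
    adapted M F T (L2per L) (L2norm (cell L)) P \<and>
    (\<lambda>w t. P t w) \<in> bochner_L2 M (bochner_L2 (time T) (Hper L 1) (Hnorm L 1))
                      (bochner_L2_norm (time T) (Hnorm L 1)) \<and>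
    (\<exists>J. ito_integral M F W (L2per L) (L2norm (cell L)) T (\<lambda>s w. G (u s w)) J \<and>
       (AE w in M. \<forall>t\<in>{0<..T}. P t w \<in> L2per L \<and>
          (\<forall>\<phi>\<in>Hper L 1.
             ip (cell L) (u t w) \<phi> + (LINT s:{0..t}|lborel. grad_ip L (u s w) \<phi>)
               - ip (cell L) (dvg L \<phi>) (P t w) =
             ip (cell L) (u0 w) \<phi> + ip (cell L) (J t w) \<phi>) \<and>
          (\<forall>q\<in>L2per L. ip (cell L) (dvg L (u t w)) q = 0))) \<and>
    (AE w in M. L2norm (cell L) (P 0 w) = 0)"

text \<open>
  The iterates of the Milstein scheme with \<open>K\<close> steps. They are only required to be random
  variables; that they are adapted follows from the equations.
\<close>

definition milstein_scheme ::
  "'w measure \<Rightarrow> (real \<Rightarrow> 'w \<Rightarrow> real) \<Rightarrow> real \<Rightarrow> real \<Rightarrow>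
   ('d::finite) field_map \<Rightarrow> ((real^'d \<Rightarrow> real^'d) \<Rightarrow> 'd field_map) \<Rightarrow>
   ('w \<Rightarrow> real^'d \<Rightarrow> real^'d) \<Rightarrow> nat \<Rightarrow>
   (nat \<Rightarrow> 'w \<Rightarrow> real^'d \<Rightarrow> real^'d) \<Rightarrow> (nat \<Rightarrow> 'w \<Rightarrow> real^'d \<Rightarrow> real) \<Rightarrow> bool"
  where "milstein_scheme M W T L G DG u0 K uh ph \<longleftrightarrow>
    (let k = T / real K; \<Delta>W = (\<lambda>n w. W (real (Suc n) * k) w - W (real n * k) w) in
      uh 0 = u0 \<and>
      (\<forall>n<K.
         strongly_measurable M M (V L) (Hnorm L 1) (uh (Suc n)) \<and>
         strongly_measurable M M (L2per L) (L2norm (cell L)) (ph (Suc n)) \<and>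
         (AE w in M.
            (\<forall>\<phi>\<in>Hper L 1.
               ip (cell L) (uh (Suc n) w - uh n w) \<phi> + k * grad_ip L (uh (Suc n) w) \<phi>
                 - k * ip (cell L) (ph (Suc n) w) (dvg L \<phi>) =
               ip (cell L)
                 (\<Delta>W n w *\<^sub>R G (uh n w)
                   + (1 / 2) *\<^sub>R ((\<Delta>W n w)\<^sup>2 - k) *\<^sub>R DG (uh n w) (G (uh n w))) \<phi>) \<and>
            (\<forall>\<psi>\<in>L2per L. ip (cell L) (dvg L (uh (Suc n) w)) \<psi> = 0))))"

end

(*
  On the torus both pressures vanish, so the error is zero. A field phi that is the gradient of a
  trigonometric polynomial is orthogonal to every divergence-free field, and so are its
  derivatives; by (A4) the noise coefficient is divergence-free, and so is DG(u)G(u) as an L2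
  limit of difference quotients of G. Testing either equation with such a phi therefore leaves
  only the pressure term. The stochastic integral drops out by the Ito isometry, applied to the
  scalar process obtained by pairing the integrand with phi. Hence the pressure is orthogonal to
  all nonconstant trigonometric functions, and it has mean zero, so it is zero.
*)

theory Submission
  imports Defs
begin

section \<open>The Ito isometry\<close>

lemma normal_increment_moments:
  assumes "prob_space M" and "0 < \<sigma>"
    and D: "distributed M lborel X (normal_density 0 \<sigma>)"
  shows "integrable M X" "integrable M (\<lambda>w. (X w)\<^sup>2)" "integral\<^sup>L M X = 0"
    "integral\<^sup>L M (\<lambda>w. (X w)\<^sup>2) = \<sigma>\<^sup>2"
proof -
  interpret prob_space M by fact
  show "integrable M X"
    using distributed_integrable[OF D, of "\<lambda>x. x"] integrable_normal_moment_nz_1[OF \<open>0 < \<sigma>\<close>, of 0]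
    by simp
  show "integrable M (\<lambda>w. (X w)\<^sup>2)"
    using distributed_integrable[OF D, of "\<lambda>x. x\<^sup>2"] integrable_normal_moment[OF \<open>0 < \<sigma>\<close>, of 0 2]
    by simp
  show 0: "integral\<^sup>L M X = 0"
    by (rule normal_distributed_expectation[OF \<open>0 < \<sigma>\<close> D])
  show "integral\<^sup>L M (\<lambda>w. (X w)\<^sup>2) = \<sigma>\<^sup>2"
    using normal_distributed_variance[OF \<open>0 < \<sigma>\<close> D] 0 by simp
qed

lemma wiener_increment:
  assumes F: "filtered_prob_space M F" and W: "wiener_process M F W"
    and "0 \<le> s" "s \<le> t"
  shows "integrable M (\<lambda>w. W t w - W s w)" "integrable M (\<lambda>w. (W t w - W s w)\<^sup>2)"
    "integral\<^sup>L M (\<lambda>w. W t w - W s w) = 0"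
    "integral\<^sup>L M (\<lambda>w. (W t w - W s w)\<^sup>2) = t - s"
proof -
  have M: "prob_space M" using F by (simp add: filtered_prob_space_def)
  have "integrable M (\<lambda>w. W t w - W s w) \<and> integrable M (\<lambda>w. (W t w - W s w)\<^sup>2) \<and>
    integral\<^sup>L M (\<lambda>w. W t w - W s w) = 0 \<and> integral\<^sup>L M (\<lambda>w. (W t w - W s w)\<^sup>2) = t - s"
  proof (cases "s = t")
    case False
    with assms have "s < t" by simp
    have "distributed M lborel (\<lambda>w. W t w - W s w) (normal_density 0 (sqrt (t - s)))"
      using W \<open>0 \<le> s\<close> \<open>s < t\<close> unfolding wiener_process_def by auto
    from normal_increment_moments[OF M _ this] \<open>s < t\<close> show ?thesis by simp
  qed simp
  then show "integrable M (\<lambda>w. W t w - W s w)" "integrable M (\<lambda>w. (W t w - W s w)\<^sup>2)"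
    "integral\<^sup>L M (\<lambda>w. W t w - W s w) = 0"
    "integral\<^sup>L M (\<lambda>w. (W t w - W s w)\<^sup>2) = t - s" by auto
qed

lemma wiener_increment_indep:
  assumes F: "filtered_prob_space M F" and W: "wiener_process M F W"
    and "0 \<le> s" "s < t" and Y: "Y \<in> borel_measurable (F s)"
  shows "prob_space.indep_var M borel Y borel (\<lambda>w. W t w - W s w)"
proof -
  interpret prob_space M using F by (simp add: filtered_prob_space_def)
  have sub: "subalgebra M (F s)" using F \<open>0 \<le> s\<close> by (simp add: filtered_prob_space_def)
  then have sp: "space (F s) = space M" by (simp add: subalgebra_def)
  have D: "distributed M lborel (\<lambda>w. W t w - W s w) (normal_density 0 (sqrt (t - s)))"
    and ind: "indep_set (sets (F s))
         {(\<lambda>w. W t w - W s w) -` A \<inter> space M |A. A \<in> sets borel}"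
      using W \<open>0 \<le> s\<close> \<open>s < t\<close> unfolding wiener_process_def by auto
  have 1: "Y \<in> borel_measurable M"
    using measurable_from_subalg[OF sub Y] .
  have 2: "(\<lambda>w. W t w - W s w) \<in> borel_measurable M"
    using distributed_measurable[OF D] by simp
  have subY: "sigma_sets (space M) {Y -` A \<inter> space M |A. A \<in> sets borel} \<subseteq> sets (F s)"
    unfolding sp[symmetric]
    by (rule sets.sigma_sets_subset) (auto intro: measurable_sets[OF Y])
  have eq: "sigma_sets (space M) {(\<lambda>w. W t w - W s w) -` A \<inter> space M |A. A \<in> sets borel}
     = {(\<lambda>w. W t w - W s w) -` A \<inter> space M |A. A \<in> sets borel}"
    using sigma_sets_vimage_commute[of "\<lambda>w. W t w - W s w" "space M" UNIV "sets borel", symmetric]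
    by (simp only: sets.sigma_sets_eq[of borel, unfolded space_borel]) auto
  have "indep_set (sigma_sets (space M) {Y -` A \<inter> space M |A. A \<in> sets borel})
      (sigma_sets (space M) {(\<lambda>w. W t w - W s w) -` A \<inter> space M |A. A \<in> sets borel})"
    unfolding eq
    by (rule indep_setI[OF subset_trans[OF subY indep_setD_ev1[OF ind]] indep_setD_ev2[OF ind]])
       (rule indep_setD[OF ind subsetD[OF subY]])
  then show ?thesis using 1 2 by (simp add: indep_var_eq)
qed

lemma elementary_ito_isometry:
  assumes F: "filtered_prob_space M F" and W: "wiener_process M F W"
    and \<tau>0: "0 \<le> \<tau> 0" and \<tau>: "\<And>i. i < m \<Longrightarrow> \<tau> i \<le> \<tau> (Suc i)"
    and \<eta>: "\<And>i. i < m \<Longrightarrow> simple_function (F (\<tau> i)) (\<eta> i :: 'w \<Rightarrow> real)"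
  shows "integrable M (\<lambda>w. (\<Sum>i<m. (W (\<tau> (Suc i)) w - W (\<tau> i) w) * \<eta> i w)\<^sup>2)"
    and "(\<integral>w. (\<Sum>i<m. (W (\<tau> (Suc i)) w - W (\<tau> i) w) * \<eta> i w)\<^sup>2 \<partial>M)
        = (\<Sum>i<m. (\<tau> (Suc i) - \<tau> i) * (\<integral>w. (\<eta> i w)\<^sup>2 \<partial>M))"
proof -
  interpret prob_space M using F by (simp add: filtered_prob_space_def)
  have pos: "0 \<le> \<tau> i" if "i \<le> m" for i
    using that
  proof (induction i)
    case (Suc i) then show ?case using \<tau>[of i] by auto
  qed (use \<tau>0 in simp)
  have sub: "subalgebra M (F (\<tau> i))" if "i \<le> m" for i
    using F pos[OF that] by (simp add: filtered_prob_space_def)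
  have mono: "\<tau> i \<le> \<tau> j" if "i \<le> j" "j \<le> m" for i j
    using that
  proof (induction j)
    case (Suc j) then show ?case using \<tau>[of j] by (cases "i = Suc j") auto
  qed simp
  have subF: "subalgebra (F (\<tau> j)) (F (\<tau> i))" if "i \<le> j" "j \<le> m" for i j
    using F pos[of i] mono[OF that] that by (simp add: filtered_prob_space_def)
  define S where "S j w = (\<Sum>i<j. (W (\<tau> (Suc i)) w - W (\<tau> i) w) * \<eta> i w)" for j w
  have Wm: "W (\<tau> i) \<in> borel_measurable (F (\<tau> j))" if "i \<le> j" "j \<le> m" for i j
    by (rule measurable_from_subalg[OF subF[OF that]])
       (use W pos[of i] that in \<open>auto simp: wiener_process_def\<close>)
  have \<eta>m: "\<eta> i \<in> borel_measurable (F (\<tau> j))" if "i \<le> j" "j \<le> m" "i < m" for i j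
    by (rule measurable_from_subalg[OF subF[OF that(1,2)]])
       (use \<eta>[OF that(3)] in \<open>auto intro: borel_measurable_simple_function\<close>)
  have SF: "S j \<in> borel_measurable (F (\<tau> j))" if "j \<le> m" for j
    unfolding S_def using that
    by (intro borel_measurable_sum borel_measurable_times borel_measurable_diff Wm \<eta>m) auto
  have bdd: "\<exists>B. \<forall>w\<in>space M. \<bar>\<eta> i w\<bar> \<le> B" if "i < m" for i
  proof -
    have "finite (\<eta> i ` space M)"
      using \<eta>[OF that] sub[of i] that by (auto simp: simple_function_def subalgebra_def)
    then have "bounded (\<eta> i ` space M)" by (rule finite_imp_bounded)
    then show ?thesis by (auto simp: bounded_iff)
  qed
  have main: "integrable M (\<lambda>w. (S j w)\<^sup>2) \<and>
    (\<integral>w. (S j w)\<^sup>2 \<partial>M) = (\<Sum>i<j. (\<tau> (Suc i) - \<tau> i) * (\<integral>w. (\<eta> i w)\<^sup>2 \<partial>M))" if "j \<le> m" for j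
    using that
  proof (induction j)
    case 0 then show ?case by (simp add: S_def)
  next
    case (Suc j)
    then have IH: "integrable M (\<lambda>w. (S j w)\<^sup>2)"
      "(\<integral>w. (S j w)\<^sup>2 \<partial>M) = (\<Sum>i<j. (\<tau> (Suc i) - \<tau> i) * (\<integral>w. (\<eta> i w)\<^sup>2 \<partial>M))" and j: "j < m" by auto
    define D where "D w = W (\<tau> (Suc j)) w - W (\<tau> j) w" for w
    have tj: "0 \<le> \<tau> j" "\<tau> j \<le> \<tau> (Suc j)" using pos[of j] \<tau>[of j] j by auto
    note D = wiener_increment[OF F W tj, folded D_def]
    obtain B where B: "\<And>w. w \<in> space M \<Longrightarrow> \<bar>\<eta> j w\<bar> \<le> B" using bdd[OF j] by auto
    have Sm: "S j \<in> borel_measurable M"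
      using measurable_from_subalg[OF sub SF[of j]] j by auto
    have em: "\<eta> j \<in> borel_measurable M"
      using measurable_from_subalg[OF sub \<eta>m[of j j]] j by auto
    have S1: "integrable M (S j)"
      using square_integrable_imp_integrable[OF Sm IH(1)] by (auto simp: integrable_iff_bounded)
    have Seta: "integrable M (\<lambda>w. 2 * (S j w * \<eta> j w))"
    proof (intro integrable_mult_right Bochner_Integration.integrable_bound[OF integrable_mult_right[OF S1, of B]] AE_I2)
      fix w assume "w \<in> space M"
      then show "norm (S j w * \<eta> j w) \<le> norm (B * S j w)"
        using mult_right_mono[OF order_trans[OF B abs_ge_self], of w "\<bar>S j w\<bar>"]
        by (simp add: abs_mult mult.commute)
    qed (use Sm em in simp)
    have eta2: "integrable M (\<lambda>w. (\<eta> j w)\<^sup>2)"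
    proof (rule integrable_const_bound[where B="B\<^sup>2"])
      show "AE w in M. norm ((\<eta> j w)\<^sup>2) \<le> B\<^sup>2"
        using order_trans[OF B abs_ge_self] by (auto intro!: AE_I2 simp flip: abs_le_square_iff)
    qed (use em in simp)
    have cross: "integrable M (\<lambda>w. 2 * (S j w * \<eta> j w) * D w) \<and> (\<integral>w. 2 * (S j w * \<eta> j w) * D w \<partial>M) = 0
      \<and> integrable M (\<lambda>w. (\<eta> j w)\<^sup>2 * (D w)\<^sup>2) \<and>
      (\<integral>w. (\<eta> j w)\<^sup>2 * (D w)\<^sup>2 \<partial>M) = (\<integral>w. (\<eta> j w)\<^sup>2 \<partial>M) * (\<tau> (Suc j) - \<tau> j)"
    proof (cases "\<tau> j = \<tau> (Suc j)")
      case True then show ?thesis by (simp add: D_def)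
    next
      case False
      then have lt: "\<tau> j < \<tau> (Suc j)" using tj by simp
      have m1: "(\<lambda>w. 2 * (S j w * \<eta> j w)) \<in> borel_measurable (F (\<tau> j))"
        using SF[of j] \<eta>m[of j j] j by (intro borel_measurable_times) auto
      have i1: "indep_var borel (\<lambda>w. 2 * (S j w * \<eta> j w)) borel D"
        unfolding D_def by (rule wiener_increment_indep[OF F W tj(1) lt m1])
      have i2: "indep_var borel (\<lambda>w. (\<eta> j w)\<^sup>2) borel (\<lambda>w. (D w)\<^sup>2)"
        using indep_var_compose[OF wiener_increment_indep[OF F W tj(1) lt \<eta>m[of j j]], of "\<lambda>x. x\<^sup>2" borel "\<lambda>x. x\<^sup>2" borel] j
        by (simp add: comp_def D_def)
      show ?thesis
        using indep_var_integrable[OF i1 Seta D(1)] indep_var_lebesgue_integral[OF i1 Seta D(1)]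
          indep_var_integrable[OF i2 eta2 D(2)] indep_var_lebesgue_integral[OF i2 eta2 D(2)] D(3,4)
        by simp
    qed
    have eq: "(S (Suc j) w)\<^sup>2 = (S j w)\<^sup>2 + 2 * (S j w * \<eta> j w) * D w + (\<eta> j w)\<^sup>2 * (D w)\<^sup>2" for w
      by (simp add: S_def D_def power2_eq_square algebra_simps)
    show ?case
      unfolding eq using IH cross by (simp add: mult.commute)
  qed
  show "integrable M (\<lambda>w. (\<Sum>i<m. (W (\<tau> (Suc i)) w - W (\<tau> i) w) * \<eta> i w)\<^sup>2)"
    and "(\<integral>w. (\<Sum>i<m. (W (\<tau> (Suc i)) w - W (\<tau> i) w) * \<eta> i w)\<^sup>2 \<partial>M)
        = (\<Sum>i<m. (\<tau> (Suc i) - \<tau> i) * (\<integral>w. (\<eta> i w)\<^sup>2 \<partial>M))"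
    using main[of m] unfolding S_def by auto
qed

lemma nn_integral_elementary_process_sq:
  assumes "prob_space M"
    and \<tau>0: "0 \<le> \<tau> 0" and \<tau>: "\<And>i. i < m \<Longrightarrow> \<tau> i \<le> \<tau> (Suc i)" and \<tau>m: "\<tau> m \<le> t"
    and \<eta>: "\<And>i. i < m \<Longrightarrow> simple_function M (\<eta> i :: 'w \<Rightarrow> real)"
  shows "(\<integral>\<^sup>+(s, w). ennreal ((\<Sum>i<m. indicator {\<tau> i<..\<tau> (Suc i)} s * \<eta> i w)\<^sup>2) \<partial>(time t \<Otimes>\<^sub>M M))
    = ennreal (\<Sum>i<m. (\<tau> (Suc i) - \<tau> i) * (\<integral>w. (\<eta> i w)\<^sup>2 \<partial>M))"
proof -
  interpret prob_space M by fact
  have mono: "\<tau> i \<le> \<tau> j" if "i \<le> j" "j \<le> m" for i j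
    using that
  proof (induction j)
    case (Suc j) then show ?case using \<tau>[of j] by (cases "i = Suc j") auto
  qed simp
  have sq: "(\<Sum>i<j. indicator {\<tau> i<..\<tau> (Suc i)} s * \<eta> i w)\<^sup>2
      = (\<Sum>i<j. indicator {\<tau> i<..\<tau> (Suc i)} s * (\<eta> i w)\<^sup>2)" if "j \<le> m" for s w j
    using that
  proof (induction j)
    case (Suc j)
    have "indicator {\<tau> j<..\<tau> (Suc j)} s * (\<Sum>i<j. indicator {\<tau> i<..\<tau> (Suc i)} s * \<eta> i w) = 0"
    proof (cases "s \<in> {\<tau> j<..\<tau> (Suc j)}")
      case True
      have "s \<notin> {\<tau> i<..\<tau> (Suc i)}" if "i < j" for i
        using mono[of "Suc i" j] that Suc.prems True by auto
      then show ?thesis by (simp add: sum.neutral)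
    qed simp
    then show ?case
      using Suc by (auto simp: power2_eq_square algebra_simps indicator_def)
  qed simp
  have em [measurable]: "\<eta> i \<in> borel_measurable M" if "i < m" for i
    using \<eta>[OF that] by (rule borel_measurable_simple_function)
  have int: "integrable M (\<lambda>w. (\<eta> i w)\<^sup>2)" if "i < m" for i
  proof -
    have "finite (\<eta> i ` space M)" using \<eta>[OF that] by (auto simp: simple_function_def)
    then have "bounded (\<eta> i ` space M)" by (rule finite_imp_bounded)
    then obtain B where B: "\<And>w. w \<in> space M \<Longrightarrow> \<bar>\<eta> i w\<bar> \<le> B" by (auto simp: bounded_iff)
    show ?thesis
    proof (rule integrable_const_bound[where B="B\<^sup>2"])
      show "AE w in M. norm ((\<eta> i w)\<^sup>2) \<le> B\<^sup>2"
        using order_trans[OF B abs_ge_self] by (auto intro!: AE_I2 simp flip: abs_le_square_iff)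
    qed (use em[OF that] in simp)
  qed
  have ind: "(indicator A :: real \<Rightarrow> ennreal) \<in> borel_measurable (time t)" if "A \<in> sets borel" for A
    using that unfolding time_def by (intro measurable_restrict_space1) simp
  have meas: "(\<lambda>z. indicator {\<tau> i<..\<tau> (Suc i)} (fst z) * ennreal ((\<eta> i (snd z))\<^sup>2))
      \<in> borel_measurable (time t \<Otimes>\<^sub>M M)" if "i < m" for i
    using em[OF that] by (intro borel_measurable_times_ennreal measurable_compose[OF measurable_fst ind]) auto
  have tm: "(\<integral>\<^sup>+s. indicator {\<tau> i<..\<tau> (Suc i)} s \<partial>time t) = ennreal (\<tau> (Suc i) - \<tau> i)" if "i < m" for i
  proof -
    have "{\<tau> i<..\<tau> (Suc i)} \<subseteq> {0..t}"
      using mono[of 0 i] mono[of "Suc i" m] that \<tau>0 \<tau>m by auto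
    then show ?thesis
      using \<tau>[OF that] unfolding time_def
      by (subst nn_integral_restrict_space)
         (auto simp: indicator_inter_arith[symmetric] Int_absorb2 simp flip: inf_set_def)
  qed
  have "(\<integral>\<^sup>+(s, w). ennreal ((\<Sum>i<m. indicator {\<tau> i<..\<tau> (Suc i)} s * \<eta> i w)\<^sup>2) \<partial>(time t \<Otimes>\<^sub>M M))
    = (\<integral>\<^sup>+z. (\<Sum>i<m. indicator {\<tau> i<..\<tau> (Suc i)} (fst z) * ennreal ((\<eta> i (snd z))\<^sup>2)) \<partial>(time t \<Otimes>\<^sub>M M))"
    by (intro nn_integral_cong, simp only: split_beta sq[OF order_refl], subst sum_ennreal[symmetric])
       (auto simp: ennreal_mult ennreal_indicator simp del: sum_ennreal intro!: sum.cong split: split_indicator)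
  also have "\<dots> = (\<Sum>i<m. \<integral>\<^sup>+z. indicator {\<tau> i<..\<tau> (Suc i)} (fst z) * ennreal ((\<eta> i (snd z))\<^sup>2) \<partial>(time t \<Otimes>\<^sub>M M))"
    by (intro nn_integral_sum meas) simp
  also have "\<dots> = (\<Sum>i<m. ennreal ((\<tau> (Suc i) - \<tau> i) * (\<integral>w. (\<eta> i w)\<^sup>2 \<partial>M)))"
  proof (intro sum.cong refl)
    fix i assume "i \<in> {..<m}" then have i: "i < m" by simp
    note [measurable] = em[OF i]
    have "(\<integral>\<^sup>+z. indicator {\<tau> i<..\<tau> (Suc i)} (fst z) * ennreal ((\<eta> i (snd z))\<^sup>2) \<partial>(time t \<Otimes>\<^sub>M M))
      = (\<integral>\<^sup>+s. \<integral>\<^sup>+w. indicator {\<tau> i<..\<tau> (Suc i)} s * ennreal ((\<eta> i w)\<^sup>2) \<partial>M \<partial>time t)"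
      by (subst nn_integral_fst[OF meas[OF i], symmetric]) simp
    also have "\<dots> = (\<integral>\<^sup>+s. indicator {\<tau> i<..\<tau> (Suc i)} s * ennreal (\<integral>w. (\<eta> i w)\<^sup>2 \<partial>M) \<partial>time t)"
      by (simp add: nn_integral_cmult nn_integral_eq_integral[OF int[OF i]])
    also have "\<dots> = ennreal ((\<tau> (Suc i) - \<tau> i) * (\<integral>w. (\<eta> i w)\<^sup>2 \<partial>M))"
      using \<tau>[OF i] by (subst nn_integral_multc) (auto simp: tm[OF i] ennreal_mult intro: ind)
    finally show "(\<integral>\<^sup>+z. indicator {\<tau> i<..\<tau> (Suc i)} (fst z) * ennreal ((\<eta> i (snd z))\<^sup>2) \<partial>(time t \<Otimes>\<^sub>M M))
      = ennreal ((\<tau> (Suc i) - \<tau> i) * (\<integral>w. (\<eta> i w)\<^sup>2 \<partial>M))" .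
  qed
  also have "\<dots> = ennreal (\<Sum>i<m. (\<tau> (Suc i) - \<tau> i) * (\<integral>w. (\<eta> i w)\<^sup>2 \<partial>M))"
    using \<tau> by (intro sum_ennreal) (auto intro!: mult_nonneg_nonneg)
  finally show ?thesis .
qed

definition contractive_functional :: "'b::real_vector set \<Rightarrow> ('b \<Rightarrow> real) \<Rightarrow> ('b \<Rightarrow> real) \<Rightarrow> bool"
  where "contractive_functional X nrm ell \<longleftrightarrow>
    (\<forall>x\<in>X. \<forall>y\<in>X. \<forall>a b. ell (a *\<^sub>R x + b *\<^sub>R y) = a * ell x + b * ell y) \<and> (\<forall>x\<in>X. \<bar>ell x\<bar> \<le> nrm x)"

text \<open>
  The elementary processes approximating \<open>\<Phi>\<close> need not take values in the kernel of \<open>ell\<close>, so the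
  isometry is applied to their images under \<open>ell\<close>, which tend to zero in the mean square. Since
  \<open>\<Phi>\<close> and \<open>I\<close> need not be measurable as functions, \<open>ell \<circ> I\<close> is replaced by a limit \<open>c\<close> of
  simple functions before integrals are added.
\<close>

lemma ito_integral_in_kernel:
  fixes I :: "'w \<Rightarrow> 'b::real_vector"
  assumes F: "filtered_prob_space M F" and W: "wiener_process M F W" and "0 \<le> t"
    and X: "subspace X" and ell: "contractive_functional X nrm ell"
    and ito: "ito_integral_at M F W X nrm t \<Phi> I"
    and ker: "AE w in M. \<forall>s\<in>{0..t}. \<Phi> s w \<in> X \<and> ell (\<Phi> s w) = 0"
  shows "AE w in M. ell (I w) = 0"
proof -
  interpret prob_space M using F by (simp add: filtered_prob_space_def)
  have lin: "ell (a *\<^sub>R x + b *\<^sub>R y) = a * ell x + b * ell y" if "x \<in> X" "y \<in> X" for x y a b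
    using ell that unfolding contractive_functional_def by blast
  have le: "\<bar>ell x\<bar> \<le> nrm x" if "x \<in> X" for x
    using ell that unfolding contractive_functional_def by blast
  have diff: "ell (x - y) = ell x - ell y" if "x \<in> X" "y \<in> X" for x y
    using lin[OF that, of 1 "-1"] by simp
  have zero: "ell 0 = 0" using lin[of 0 0 0 0] subspace_0[OF X] by simp
  have sum: "ell (\<Sum>i<j. c i *\<^sub>R x i) = (\<Sum>i<j. c i * ell (x i)) \<and> (\<Sum>i<j. c i *\<^sub>R x i) \<in> X"
    if "\<And>i. i < j \<Longrightarrow> x i \<in> X" for c :: "nat \<Rightarrow> real" and x j
    using that
  proof (induction j)
    case 0 then show ?case using zero subspace_0[OF X] by simp
  next
    case (Suc j)
    then have *: "ell (\<Sum>i<j. c i *\<^sub>R x i) = (\<Sum>i<j. c i * ell (x i))" "(\<Sum>i<j. c i *\<^sub>R x i) \<in> X" by auto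
    show ?case
      using lin[OF *(2) Suc.prems[of j], of 1 "c j"] *(1)
        subspace_add[OF X *(2) subspace_scale[OF X Suc.prems[of j], of "c j"]]
      by simp
  qed
  obtain m \<tau> \<xi> where el: "\<And>n::nat. elementary F X t (m n) (\<tau> n) (\<xi> n)"
    and lim1: "(\<lambda>n. sq_norm_integral (time t \<Otimes>\<^sub>M M) nrm
              (\<lambda>(s, w). elementary_process (m n) (\<tau> n) (\<xi> n) s w - \<Phi> s w)) \<longlonglongrightarrow> 0"
    and lim2: "(\<lambda>n. sq_norm_integral M nrm
              (\<lambda>w. elementary_integral W (m n) (\<tau> n) (\<xi> n) w - I w)) \<longlonglongrightarrow> 0"
    and I: "I \<in> bochner_L2 M X nrm"
    using ito unfolding ito_integral_at_def by blast
  define \<eta> where "\<eta> n i w = ell (\<xi> n i w)" for n i w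
  have \<tau>: "0 \<le> \<tau> n 0" "\<tau> n (m n) \<le> t" "\<And>i. i < m n \<Longrightarrow> \<tau> n i \<le> \<tau> n (Suc i)"
    and \<xi>F: "\<And>i. i < m n \<Longrightarrow> simple_function (F (\<tau> n i)) (\<xi> n i)"
    and \<xi>X': "\<And>i. i < m n \<Longrightarrow> \<xi> n i ` space (F (\<tau> n i)) \<subseteq> X" for n
    using el[of n] unfolding elementary_def by auto
  have \<tau>pos: "0 \<le> \<tau> n i" if "i \<le> m n" for n i
    using that
  proof (induction i)
    case (Suc i) then show ?case using \<tau>(3)[of i n] by auto
  qed (use \<tau> in simp)
  have sub: "subalgebra M (F (\<tau> n i))" if "i < m n" for n i
    using F \<tau>pos[of i n] that by (simp add: filtered_prob_space_def)
  have \<xi>X: "\<xi> n i w \<in> X" if "i < m n" "w \<in> space M" for n i w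
    using \<xi>X'[OF that(1)] sub[OF that(1)] that(2) by (auto simp: subalgebra_def)
  have \<eta>F: "simple_function (F (\<tau> n i)) (\<eta> n i)" if "i < m n" for n i
    unfolding \<eta>_def using simple_function_compose[OF \<xi>F[OF that], of ell] by (simp add: comp_def)
  have \<eta>M: "simple_function M (\<eta> n i)" if "i < m n" for n i
    using \<eta>F[OF that] sub[OF that] unfolding simple_function_def subalgebra_def by auto
  define a where "a n s w = (\<Sum>i<m n. indicator {\<tau> n i<..\<tau> n (Suc i)} s * \<eta> n i w)" for n s w
  define b where "b n w = (\<Sum>i<m n. (W (\<tau> n (Suc i)) w - W (\<tau> n i) w) * \<eta> n i w)" for n w
  have sum': "ell (\<Sum>i<m n. c i *\<^sub>R \<xi> n i w) = (\<Sum>i<m n. c i * ell (\<xi> n i w))"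
      "(\<Sum>i<m n. c i *\<^sub>R \<xi> n i w) \<in> X" if "w \<in> space M" for n c w
    using sum[of "m n" "\<lambda>i. \<xi> n i w" c] \<xi>X[OF _ that] by blast+
  have a: "ell (elementary_process (m n) (\<tau> n) (\<xi> n) s w) = a n s w"
      "elementary_process (m n) (\<tau> n) (\<xi> n) s w \<in> X" if "w \<in> space M" for n s w
    using sum'[OF that]
    unfolding elementary_process_def a_def \<eta>_def by (simp_all only:)
  have b: "ell (elementary_integral W (m n) (\<tau> n) (\<xi> n) w) = b n w"
      "elementary_integral W (m n) (\<tau> n) (\<xi> n) w \<in> X" if "w \<in> space M" for n w
    using sum'[OF that]
    unfolding elementary_integral_def b_def \<eta>_def by (simp_all only:)
  have bint: "integrable M (\<lambda>w. (b n w)\<^sup>2)" for n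
    unfolding b_def
    by (rule elementary_ito_isometry(1)[where \<tau>="\<tau> n" and \<eta>="\<eta> n", OF F W \<tau>(1) \<tau>(3) \<eta>F])
  have bm [measurable]: "b n \<in> borel_measurable M" for n
  proof -
    have "W (\<tau> n i) \<in> borel_measurable M" if "i \<le> m n" for i
    proof -
      have "W (\<tau> n i) \<in> borel_measurable (F (\<tau> n i))" and "subalgebra M (F (\<tau> n i))"
        using W F \<tau>pos[OF that] by (auto simp: wiener_process_def filtered_prob_space_def)
      then show ?thesis using measurable_from_subalg by blast
    qed
    then show ?thesis
      unfolding b_def
      by (intro borel_measurable_sum borel_measurable_times borel_measurable_diff
          borel_measurable_simple_function[OF \<eta>M]) auto
  qed
  have iso: "(\<integral>\<^sup>+w. ennreal ((b n w)\<^sup>2) \<partial>M) = (\<integral>\<^sup>+(s, w). ennreal ((a n s w)\<^sup>2) \<partial>(time t \<Otimes>\<^sub>M M))" for n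
    using elementary_ito_isometry(2)[where \<tau>="\<tau> n" and \<eta>="\<eta> n", OF F W \<tau>(1) \<tau>(3) \<eta>F]
      nn_integral_elementary_process_sq
        [where \<tau>="\<tau> n" and \<eta>="\<eta> n", OF prob_space_axioms \<tau>(1) \<tau>(3) \<tau>(2) \<eta>M]
    by (subst nn_integral_eq_integral[OF bint]) (auto simp: a_def b_def)
  obtain N where N: "N \<in> null_sets M"
    and Nker: "\<And>w s. w \<in> space M - N \<Longrightarrow> s \<in> {0..t} \<Longrightarrow> \<Phi> s w \<in> X \<and> ell (\<Phi> s w) = 0"
    using ker by (elim AE_E3) blast
  have null0: "space (time t) \<times> N \<in> null_sets (time t \<Otimes>\<^sub>M M)"
  proof -
    have "emeasure (time t \<Otimes>\<^sub>M M) (space (time t) \<times> N) = emeasure (time t) (space (time t)) * emeasure M N"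
      using N by (intro emeasure_pair_measure_Times) auto
    then show ?thesis using N by (auto intro!: null_setsI pair_measureI)
  qed
  have z0: "z \<notin> space (time t) \<times> N \<Longrightarrow> z \<in> space (time t \<Otimes>\<^sub>M M) \<Longrightarrow>
     snd z \<in> space M - N \<and> fst z \<in> {0..t}" for z
    by (auto simp: space_pair_measure time_def space_restrict_space)
  have AEp: "AE z in time t \<Otimes>\<^sub>M M. snd z \<in> space M - N \<and> fst z \<in> {0..t}"
    by (rule AE_I'[OF null0]) (use z0 in blast)
  have ab: "(\<integral>\<^sup>+w. ennreal ((b n w)\<^sup>2) \<partial>M) \<le> sq_norm_integral (time t \<Otimes>\<^sub>M M) nrm
              (\<lambda>(s, w). elementary_process (m n) (\<tau> n) (\<xi> n) s w - \<Phi> s w)" for n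
    unfolding iso sq_norm_integral_def
  proof (rule nn_integral_mono_AE, use AEp in eventually_elim)
    fix z assume z: "snd z \<in> space M - N \<and> fst z \<in> {0..t}"
    let ?e = "elementary_process (m n) (\<tau> n) (\<xi> n) (fst z) (snd z)" and ?p = "\<Phi> (fst z) (snd z)"
    have X': "?e \<in> X" "?p \<in> X" "ell ?p = 0" "ell ?e = a n (fst z) (snd z)" using z a Nker by auto
    have "\<bar>a n (fst z) (snd z)\<bar> \<le> nrm (?e - ?p)"
      using le[OF subspace_diff[OF X X'(1,2)]] diff[OF X'(1,2)] X'(3,4) by simp
    then have "(a n (fst z) (snd z))\<^sup>2 \<le> (nrm (?e - ?p))\<^sup>2"
      using order_trans[OF _ abs_ge_self] by (simp flip: abs_le_square_iff)
    then show "(case z of (s, w) \<Rightarrow> ennreal ((a n s w)\<^sup>2))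
         \<le> ennreal ((nrm (case z of (s, w) \<Rightarrow> elementary_process (m n) (\<tau> n) (\<xi> n) s w - \<Phi> s w))\<^sup>2)"
      by (simp add: split_beta ennreal_leI)
  qed
  have lim1': "(\<lambda>n. \<integral>\<^sup>+w. ennreal ((b n w)\<^sup>2) \<partial>M) \<longlonglongrightarrow> 0"
    by (rule tendsto_sandwich[OF _ _ tendsto_const lim1]) (auto simp: ab)
  obtain \<sigma> where \<sigma>: "\<And>n. simple_function M (\<sigma> n)" "\<And>n. \<sigma> n ` space M \<subseteq> X"
     "AE w in M. (\<lambda>n::nat. nrm (\<sigma> n w - I w)) \<longlonglongrightarrow> 0" and IX: "AE w in M. I w \<in> X"
    using I unfolding bochner_L2_def strongly_measurable_def by blast
  define c where "c w = lim (\<lambda>n. ell (\<sigma> n w))" for w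
  have \<sigma>m [measurable]: "(\<lambda>w. ell (\<sigma> n w)) \<in> borel_measurable M" for n
    using simple_function_compose[OF \<sigma>(1)[of n], of ell]
    by (intro borel_measurable_simple_function) (simp add: comp_def)
  have cm [measurable]: "c \<in> borel_measurable M"
    unfolding c_def by (rule borel_measurable_lim_metric) (rule \<sigma>m)
  have cI: "AE w in M. I w \<in> X \<and> c w = ell (I w)"
    using \<sigma>(3) IX AE_space
  proof eventually_elim
    fix w assume lim: "(\<lambda>n::nat. nrm (\<sigma> n w - I w)) \<longlonglongrightarrow> 0" and IX: "I w \<in> X" and w: "w \<in> space M"
    have X': "\<sigma> n w \<in> X" for n using \<sigma>(2)[of n] w by auto
    have "(\<lambda>n. ell (\<sigma> n w) - ell (I w)) \<longlonglongrightarrow> 0"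
      by (rule tendsto_rabs_zero_cancel, rule tendsto_sandwich[OF _ _ tendsto_const lim])
         (use le[OF subspace_diff[OF X X' IX]] in \<open>auto simp: diff[OF X' IX]\<close>)
    then have "(\<lambda>n. ell (\<sigma> n w)) \<longlonglongrightarrow> ell (I w)" by (rule Lim_null[THEN iffD2])
    then show "I w \<in> X \<and> c w = ell (I w)" using IX unfolding c_def by (simp add: limI)
  qed
  have cb: "(\<integral>\<^sup>+w. ennreal ((b n w - c w)\<^sup>2) \<partial>M) \<le> sq_norm_integral M nrm
              (\<lambda>w. elementary_integral W (m n) (\<tau> n) (\<xi> n) w - I w)" for n
    unfolding sq_norm_integral_def
  proof (rule nn_integral_mono_AE, use cI AE_space in eventually_elim)
    fix w assume w: "I w \<in> X \<and> c w = ell (I w)" "w \<in> space M"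
    let ?e = "elementary_integral W (m n) (\<tau> n) (\<xi> n) w"
    have "\<bar>b n w - c w\<bar> \<le> nrm (?e - I w)"
      using le[OF subspace_diff[OF X b(2)[OF w(2)], of "I w" n]] diff[OF b(2)[OF w(2)], of "I w" n] w b(1)[OF w(2), of n]
      by simp
    then have "(b n w - c w)\<^sup>2 \<le> (nrm (?e - I w))\<^sup>2"
      using order_trans[OF _ abs_ge_self] by (simp flip: abs_le_square_iff)
    then show "ennreal ((b n w - c w)\<^sup>2) \<le> ennreal ((nrm (?e - I w))\<^sup>2)" by (rule ennreal_leI)
  qed
  have lim2': "(\<lambda>n. \<integral>\<^sup>+w. ennreal ((b n w - c w)\<^sup>2) \<partial>M) \<longlonglongrightarrow> 0"
    by (rule tendsto_sandwich[OF _ _ tendsto_const lim2]) (auto simp: cb)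
  have "(\<integral>\<^sup>+w. ennreal ((c w)\<^sup>2) \<partial>M) \<le> 2 * (\<integral>\<^sup>+w. ennreal ((b n w)\<^sup>2) \<partial>M) + 2 * (\<integral>\<^sup>+w. ennreal ((b n w - c w)\<^sup>2) \<partial>M)" for n
  proof -
    have "(c w)\<^sup>2 \<le> 2 * (b n w)\<^sup>2 + 2 * (b n w - c w)\<^sup>2" for w
    proof -
      have "0 \<le> (2 * b n w - c w)\<^sup>2" by simp
      then show ?thesis by (simp add: power2_eq_square algebra_simps)
    qed
    then have "ennreal ((c w)\<^sup>2) \<le> ennreal (2 * (b n w)\<^sup>2 + 2 * (b n w - c w)\<^sup>2)" for w
      by (rule ennreal_leI)
    then have "ennreal ((c w)\<^sup>2) \<le> 2 * ennreal ((b n w)\<^sup>2) + 2 * ennreal ((b n w - c w)\<^sup>2)" for w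
      by (simp add: ennreal_plus ennreal_mult')
    then have "(\<integral>\<^sup>+w. ennreal ((c w)\<^sup>2) \<partial>M) \<le> (\<integral>\<^sup>+w. 2 * ennreal ((b n w)\<^sup>2) + 2 * ennreal ((b n w - c w)\<^sup>2) \<partial>M)"
      by (intro nn_integral_mono) simp
    then show ?thesis by (simp add: nn_integral_add nn_integral_cmult)
  qed
  moreover have "(\<lambda>n. 2 * (\<integral>\<^sup>+w. ennreal ((b n w)\<^sup>2) \<partial>M) + 2 * (\<integral>\<^sup>+w. ennreal ((b n w - c w)\<^sup>2) \<partial>M)) \<longlonglongrightarrow> 2 * 0 + 2 * 0"
    by (intro tendsto_add ennreal_tendsto_cmult lim1' lim2') simp_all
  ultimately have "(\<integral>\<^sup>+w. ennreal ((c w)\<^sup>2) \<partial>M) \<le> 2 * 0 + 2 * 0"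
    by (intro LIMSEQ_le_const) auto
  then have "AE w in M. c w = 0"
    by (simp add: nn_integral_0_iff_AE)
  then show ?thesis using cI by eventually_elim simp
qed

section \<open>Trigonometric functions on the torus\<close>

definition freq :: "real \<Rightarrow> ('d::finite \<Rightarrow> int) \<Rightarrow> real^'d"
  where "freq L n = (\<chi> i. 2 * pi * of_int (n i) / L)"

definition wave :: "real \<Rightarrow> ('d::finite \<Rightarrow> int) \<Rightarrow> real \<Rightarrow> real^'d \<Rightarrow> real"
  where "wave L n a x = cos (freq L n \<bullet> x + a)"

lemma freq_add: "freq L (\<lambda>i. m i + n i) = freq L m + freq L n"
  and freq_diff: "freq L (\<lambda>i. m i - n i) = freq L m - freq L n"
  by (auto simp: freq_def vec_eq_iff add_divide_distrib diff_divide_distrib algebra_simps)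

lemma freq_zero [simp]: "freq L (\<lambda>i. 0) = 0"
  by (simp add: freq_def vec_eq_iff)

lemma continuous_on_wave: "continuous_on A (wave L n a)"
  unfolding wave_def by (intro continuous_intros)

lemma wave_measurable [measurable]: "wave L n a \<in> borel_measurable borel"
  by (rule borel_measurable_continuous_onI[OF continuous_on_wave])

lemma abs_wave_le: "\<bar>wave L n a x\<bar> \<le> 1"
  by (simp add: wave_def)

lemma wave_times_wave:
  "wave L m a x * wave L n b x =
    (wave L (\<lambda>i. m i - n i) (a - b) x + wave L (\<lambda>i. m i + n i) (a + b) x) / 2"
  unfolding wave_def cos_times_cos
  by (simp add: freq_add freq_diff inner_add_left inner_diff_left algebra_simps)

lemma wave_phase: "wave L n a x = cos a * wave L n 0 x + sin a * wave L n (pi/2) x"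
  by (simp add: wave_def cos_add)

definition torus :: "real \<Rightarrow> real^'d::finite \<Rightarrow> complex^'d"
  where "torus L x = (\<chi> i. cis (2 * pi * x $ i / L))"

lemma continuous_on_torus: "continuous_on A (torus L)"
  unfolding torus_def divide_inverse by (intro continuous_intros)

lemma torus_eq_imp_eq:
  assumes "0 < L" and x: "x \<in> cell L" and y: "y \<in> cbox 0 (\<chi> i. L)" and eq: "torus L x = torus L y"
  shows "x = y"
proof (rule vec_eq_iff[THEN iffD2], rule allI)
  fix i
  have xi: "0 < x $ i" "x $ i < L" using x by (auto simp: cell_def mem_box_cart)
  have yi: "0 \<le> y $ i" "y $ i \<le> L" using y by (auto simp: mem_box_cart)
  have "cis (2 * pi * x $ i / L) = cis (2 * pi * y $ i / L)"
    using eq by (simp add: torus_def vec_eq_iff)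
  then obtain k :: int where k: "2 * pi * x $ i / L = 2 * pi * y $ i / L + 2 * pi * k"
    using sin_cos_eq_iff by (metis cis.sel add.commute)
  then have "x $ i / L = y $ i / L + k"
    by (metis (no_types, opaque_lifting) distrib_left mult_cancel_left pi_neq_zero mult_eq_0_iff times_divide_eq_right zero_neq_numeral)
  then have k: "x $ i = y $ i + k * L" using \<open>0 < L\<close> by (simp add: field_simps)
  have "k = 0"
  proof (rule ccontr)
    assume "k \<noteq> 0"
    then consider "k \<ge> 1" | "k \<le> -1" by linarith
    then show False
    proof cases
      case 1
      then have "L \<le> of_int k * L" using \<open>0 < L\<close> mult_right_mono[of 1 "of_int k" L] by simp
      then show False using k xi yi by linarith
    next
      case 2
      then have "of_int k \<le> (-1 :: real)" by linarith
      then have "of_int k * L \<le> - L" using \<open>0 < L\<close> mult_right_mono[of "of_int k" "-1" L] by simp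
      then show False using k xi yi by linarith
    qed
  qed
  then show "x $ i = y $ i" using k by simp
qed

lemma sum_fun: "(\<Sum>i\<in>I. h i) x = (\<Sum>i\<in>I. h i x)" for h :: "'a \<Rightarrow> 'b \<Rightarrow> 'c::comm_monoid_add"
  by (induction I rule: infinite_finite_induct) auto

lemma polynomial_torus_in_span:
  fixes p :: "complex^'d::finite \<Rightarrow> real"
  assumes "real_polynomial_function p"
  shows "(\<lambda>x. p (torus L x)) \<in> span (range (\<lambda>(n, a). wave L n a))"
  using assms
proof (induction p rule: real_polynomial_function.induct)
  case (linear f)
  interpret f: bounded_linear f by (rule linear)
  have re: "Re (cis (2 * pi * x $ i / L)) = wave L (\<lambda>j. of_bool (j = i)) 0 x"
   and im: "Im (cis (2 * pi * x $ i / L)) = wave L (\<lambda>j. of_bool (j = i)) (- pi/2) x" for x :: "real^'d" and i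
  proof -
    have "freq L (\<lambda>j. of_bool (j = i)) \<bullet> x = 2 * pi * x $ i / L"
    proof -
      have "freq L (\<lambda>j. of_bool (j = i)) \<bullet> x = (\<Sum>j\<in>UNIV. if j = i then 2 * pi * x $ i / L else 0)"
        unfolding inner_vec_def by (intro sum.cong) (auto simp: freq_def)
      then show ?thesis by simp
    qed
    then show "Re (cis (2 * pi * x $ i / L)) = wave L (\<lambda>j. of_bool (j = i)) 0 x"
      "Im (cis (2 * pi * x $ i / L)) = wave L (\<lambda>j. of_bool (j = i)) (- pi/2) x"
      by (simp_all add: wave_def cos_diff)
  qed
  have dec: "torus L x = (\<Sum>i\<in>UNIV. wave L (\<lambda>j. of_bool (j = i)) 0 x *\<^sub>R axis i 1 +
      wave L (\<lambda>j. of_bool (j = i)) (- pi/2) x *\<^sub>R axis i \<i>)" for x :: "real^'d"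
    unfolding re[symmetric] im[symmetric]
    by (auto simp: torus_def vec_eq_iff axis_def complex_eq_iff if_distrib sum.If_cases cong: if_cong)
  have "(\<lambda>x. f (torus L x)) = (\<Sum>i\<in>UNIV. f (axis i 1) *\<^sub>R wave L (\<lambda>j. of_bool (j = i)) 0 +
      f (axis i \<i>) *\<^sub>R wave L (\<lambda>j. of_bool (j = i)) (- pi/2))"
    by (subst dec) (auto simp: fun_eq_iff f.sum f.add f.scaleR sum_fun scaleR_fun_def mult.commute)
  also have "\<dots> \<in> span (range (\<lambda>(n, a). wave L n a))"
    by (intro span_sum span_add span_scale span_base) auto
  finally show ?case .
next
  case (const c)
  have "(\<lambda>x. c) = c *\<^sub>R wave L (\<lambda>i. 0) 0"
    by (simp add: fun_eq_iff scaleR_fun_def wave_def)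
  also have "\<dots> \<in> span (range (\<lambda>(n, a). wave L n a))"
    by (intro span_scale span_base) auto
  finally show ?case .
next
  case (add f g)
  have "(\<lambda>x. f (torus L x) + g (torus L x)) = (\<lambda>x. f (torus L x)) + (\<lambda>x. g (torus L x))"
    by (simp add: fun_eq_iff)
  then show ?case using span_add[OF add.IH] by simp
next
  case (mult f g)
  have ww: "(\<lambda>x. wave L m a x * wave L n b x) \<in> span (range (\<lambda>(n, a). wave L n a))" for m n :: "'d \<Rightarrow> int" and a b
  proof -
    have "(\<lambda>x. wave L m a x * wave L n b x) =
      (1/2) *\<^sub>R (wave L (\<lambda>i. m i - n i) (a - b) + wave L (\<lambda>i. m i + n i) (a + b))"
      by (simp add: fun_eq_iff wave_times_wave scaleR_fun_def)
    also have "\<dots> \<in> span (range (\<lambda>(n, a). wave L n a))"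
      by (intro span_scale span_add span_base) auto
    finally show ?thesis .
  qed
  have wh: "(\<lambda>x. wave L m a x * h x) \<in> span (range (\<lambda>(n, a). wave L n a))"
    if "h \<in> span (range (\<lambda>(n, a). wave L n a))" for m :: "'d \<Rightarrow> int" and a h
    using that
  proof (induction h rule: span_induct_alt)
    case base
    have "(\<lambda>x. wave L m a x * 0 x) = 0" by (simp add: fun_eq_iff)
    then show ?case by (simp add: span_zero)
  next
    case (step c u h)
    then obtain n b where u: "u = wave L n b" by auto
    have "(\<lambda>x. wave L m a x * (c *\<^sub>R u + h) x) =
       c *\<^sub>R (\<lambda>x. wave L m a x * wave L n b x) + (\<lambda>x. wave L m a x * h x)"
      by (simp add: fun_eq_iff u scaleR_fun_def algebra_simps)
    then show ?case using ww step by (simp add: span_add span_scale)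
  qed
  have "(\<lambda>x. k x * h x) \<in> span (range (\<lambda>(n, a). wave L n a))"
    if h: "h \<in> span (range (\<lambda>(n, a). wave L n a))" and k: "k \<in> span (range (\<lambda>(n, a). wave L n a))"
    for h k :: "real^'d \<Rightarrow> real"
    using k
  proof (induction k rule: span_induct_alt)
    case base
    have "(\<lambda>x. 0 x * h x) = 0" by (simp add: fun_eq_iff)
    then show ?case by (simp add: span_zero)
  next
    case (step c u k)
    then obtain n b where u: "u = wave L n b" by auto
    have "(\<lambda>x. (c *\<^sub>R u + k) x * h x) =
       c *\<^sub>R (\<lambda>x. wave L n b x * h x) + (\<lambda>x. k x * h x)"
      by (simp add: fun_eq_iff u scaleR_fun_def algebra_simps)
    then show ?case using wh[OF h] step by (simp add: span_add span_scale)
  qed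
  then show ?case using mult.IH by blast
qed

lemma cell_subset_cbox: "cell L \<subseteq> cbox 0 (\<chi> i. L)"
  by (auto simp: cell_def box_subset_cbox)

text \<open>
  The map \<open>torus L\<close> is injective on the open cell, and no point of the cell has the same image as
  a boundary point. The indicator of a closed set is thus a pointwise limit, on the cell, of
  continuous functions of \<open>torus L x\<close>, and by Stone-Weierstrass these are uniform limits of
  trigonometric polynomials.
\<close>

lemma trigonometric_complete:
  fixes f :: "real^'d::finite \<Rightarrow> real"
  assumes "0 < L" and f: "set_integrable lborel (cell L) f"
    and orth: "\<And>n a. a \<in> {0, pi/2} \<Longrightarrow> (LINT x:cell L|lborel. f x * wave L n a x) = 0"
  shows "AE x in lborel. x \<in> cell L \<longrightarrow> f x = 0"
proof -
  define g where "g x = indicator (cell L) x * f x" for x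
  have g: "integrable lborel g" using f by (simp add: g_def[abs_def] set_integrable_def)
  have gm [measurable]: "g \<in> borel_measurable borel" using borel_measurable_integrable[OF g] by simp
  define B where "B = (\<integral>x. \<bar>g x\<bar> \<partial>lborel)"
  have B: "0 \<le> B" unfolding B_def by simp
  have gb: "integrable lborel (\<lambda>x. g x * h x)"
    if "h \<in> borel_measurable borel" "\<And>x. x \<in> cell L \<Longrightarrow> \<bar>h x\<bar> \<le> C" for h :: "real^'d \<Rightarrow> real" and C
  proof (rule Bochner_Integration.integrable_bound[OF integrable_mult_right[OF g, of C]])
    show "AE x in lborel. norm (g x * h x) \<le> norm (C * g x)"
    proof (rule AE_I2)
      fix x
      show "norm (g x * h x) \<le> norm (C * g x)"
      proof (cases "x \<in> cell L")
        case True
        then show ?thesis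
          using mult_left_mono[OF order_trans[OF that(2) abs_ge_self], of x "\<bar>g x\<bar>"] by (simp add: abs_mult mult.commute)
      qed (simp add: g_def)
    qed
  qed (use that in simp)
  have wi: "integrable lborel (\<lambda>x. g x * wave L n a x)" for n a
    by (rule gb[where C=1]) (auto simp: abs_wave_le)
  have w0': "(\<integral>x. g x * wave L n a x \<partial>lborel) = 0" if "a \<in> {0, pi/2}" for n a
    using orth[OF that, of n] by (simp add: set_lebesgue_integral_def g_def mult.assoc)
  have w0: "(\<integral>x. g x * wave L n a x \<partial>lborel) = 0" for n a
  proof -
    have "(\<integral>x. g x * wave L n a x \<partial>lborel) =
       (\<integral>x. cos a * (g x * wave L n 0 x) + sin a * (g x * wave L n (pi/2) x) \<partial>lborel)"
      by (intro Bochner_Integration.integral_cong refl) (subst wave_phase, simp add: algebra_simps)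
    then show ?thesis using w0' wi by simp
  qed
  have span: "integrable lborel (\<lambda>x. g x * h x) \<and> (\<integral>x. g x * h x \<partial>lborel) = 0"
    if "h \<in> span (range (\<lambda>(n, a). wave L n a))" for h
    using that
  proof (induction h rule: span_induct_alt)
    case base then show ?case by simp
  next
    case (step c u h)
    then obtain n b where u: "u = wave L n b" by auto
    have "(\<lambda>x. g x * (c *\<^sub>R u + h) x) = (\<lambda>x. c * (g x * wave L n b x) + g x * h x)"
      by (simp add: fun_eq_iff u scaleR_fun_def algebra_simps)
    then show ?case using wi w0 step.IH by simp
  qed
  have cont: "(\<integral>x. g x * h (torus L x) \<partial>lborel) = 0"
    if h: "continuous_on UNIV h" and hb: "\<And>y. \<bar>h y\<bar> \<le> 1" for h :: "complex^'d \<Rightarrow> real"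
  proof -
    let ?S = "torus L ` cbox 0 (\<chi> i. L)"
    have S: "compact ?S" by (intro compact_continuous_image continuous_on_torus compact_cbox)
    have hm: "(\<lambda>x. h (torus L x)) \<in> borel_measurable borel"
      by (intro borel_measurable_continuous_onI continuous_on_compose2[OF h continuous_on_torus]) auto
    have hi: "integrable lborel (\<lambda>x. g x * h (torus L x))"
      by (rule gb[OF hm]) (rule hb)
    have "\<bar>\<integral>x. g x * h (torus L x) \<partial>lborel\<bar> \<le> e * B" if e: "e > 0" for e
    proof -
      obtain p where p: "real_polynomial_function p" and pe: "\<And>y. y \<in> ?S \<Longrightarrow> \<bar>h y - p y\<bar> < e"
        using Stone_Weierstrass_real_polynomial_function[OF S continuous_on_subset[OF h] e] by auto
      note pi = span[OF polynomial_torus_in_span[OF p, of L]]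
      have "\<bar>\<integral>x. g x * h (torus L x) \<partial>lborel\<bar> = \<bar>\<integral>x. g x * h (torus L x) - g x * p (torus L x) \<partial>lborel\<bar>"
        using pi hi by simp
      also have "\<dots> \<le> (\<integral>x. \<bar>g x * h (torus L x) - g x * p (torus L x)\<bar> \<partial>lborel)"
        by (rule integral_abs_bound)
      also have "\<dots> \<le> (\<integral>x. e * \<bar>g x\<bar> \<partial>lborel)"
      proof (rule integral_mono)
        fix x
        show "\<bar>g x * h (torus L x) - g x * p (torus L x)\<bar> \<le> e * \<bar>g x\<bar>"
        proof (cases "x \<in> cell L")
          case True
          then have "\<bar>h (torus L x) - p (torus L x)\<bar> \<le> e"
            using pe[of "torus L x"] cell_subset_cbox[of L] by (intro less_imp_le) blast
          from mult_left_mono[OF this, of "\<bar>g x\<bar>"] show ?thesis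
            by (simp add: abs_mult[symmetric] algebra_simps)
        qed (simp add: g_def)
      qed (use pi hi g in auto)
      also have "\<dots> = e * B" by (simp add: B_def)
      finally show ?thesis .
    qed
    note le = this
    have "\<bar>\<integral>x. g x * h (torus L x) \<partial>lborel\<bar> \<le> 0"
    proof (rule field_le_epsilon)
      fix e :: real assume "e > 0"
      then have "e / (B + 1) * B \<le> e" using B by (simp add: field_simps)
      then show "\<bar>\<integral>x. g x * h (torus L x) \<partial>lborel\<bar> \<le> 0 + e"
        using le[of "e / (B + 1)"] B \<open>e > 0\<close> by simp
    qed
    then show ?thesis by simp
  qed
  have closed: "(LINT x:C|lborel. g x) = 0" if C: "closed C" for C
  proof (cases "C \<inter> cbox 0 (\<chi> i. L) = {}")
    case True
    then have "(\<lambda>x. indicator C x * g x) = (\<lambda>x. 0)"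
      using cell_subset_cbox[of L] by (auto simp: g_def indicator_def fun_eq_iff)
    then show ?thesis by (simp add: set_lebesgue_integral_def)
  next
    case False
    define K where "K = torus L ` (C \<inter> cbox 0 (\<chi> i. L))"
    have K: "compact K" "K \<noteq> {}"
      unfolding K_def using False C
      by (auto intro!: compact_continuous_image continuous_on_torus closed_Int_compact)
    have Kiff: "torus L x \<in> K \<longleftrightarrow> x \<in> C" if "x \<in> cell L" for x
      using torus_eq_imp_eq[OF \<open>0 < L\<close> that] that cell_subset_cbox[of L] unfolding K_def by blast
    define h where "h m y = max 0 (1 - real m * infdist y K)" for m y
    have hc: "continuous_on UNIV (h m)" for m unfolding h_def by (intro continuous_intros)
    have hb: "\<bar>h m y\<bar> \<le> 1" for m y
      using mult_nonneg_nonneg[OF of_nat_0_le_iff infdist_nonneg] by (auto simp: h_def max_def)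
    have hlim: "(\<lambda>m. h m y) \<longlonglongrightarrow> indicator K y" for y
    proof (cases "y \<in> K")
      case True then show ?thesis by (simp add: h_def)
    next
      case False
      then have pos: "infdist y K > 0"
        using infdist_pos_not_in_closed[OF compact_imp_closed[OF K(1)] K(2)] by auto
      obtain m0 :: nat where m0: "1 < real m0 * infdist y K" using reals_Archimedean3[OF pos] by blast
      have "h m y = 0" if "m \<ge> m0" for m
      proof -
        have "real m0 * infdist y K \<le> real m * infdist y K" using that pos by simp
        then show ?thesis using m0 by (simp add: h_def)
      qed
      then have "eventually (\<lambda>m. h m y = 0) sequentially" by (auto simp: eventually_sequentially)
      then show ?thesis using False by (simp add: tendsto_eventually)
    qed
    have hm: "(\<lambda>x. h m (torus L x)) \<in> borel_measurable borel" for m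
      by (intro borel_measurable_continuous_onI continuous_on_compose2[OF hc continuous_on_torus]) auto
    have "(\<lambda>m. \<integral>x. g x * h m (torus L x) \<partial>lborel) \<longlonglongrightarrow> (\<integral>x. g x * indicator C x \<partial>lborel)"
    proof (rule integral_dominated_convergence[where w="\<lambda>x. \<bar>g x\<bar>"])
      show "AE x in lborel. (\<lambda>m. g x * h m (torus L x)) \<longlonglongrightarrow> g x * indicator C x"
      proof (rule AE_I2)
        fix x
        have eq: "g x * indicator C x = g x * indicator K (torus L x)"
          using Kiff[of x] by (cases "x \<in> cell L") (auto simp: g_def indicator_def)
        show "(\<lambda>m. g x * h m (torus L x)) \<longlonglongrightarrow> g x * indicator C x"
          unfolding eq by (rule tendsto_mult_left[OF hlim])
      qed
      show "AE x in lborel. norm (g x * h m (torus L x)) \<le> \<bar>g x\<bar>" for m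
        using mult_left_mono[OF hb, of "\<bar>g _\<bar>" m] by (auto simp: abs_mult)
    qed (use g hm C in \<open>auto intro!: borel_measurable_times borel_measurable_indicator\<close>)
    then have "(\<integral>x. g x * indicator C x \<partial>lborel) = 0"
      using LIMSEQ_unique cont[OF hc hb] by (simp add: LIMSEQ_const_iff)
    then show ?thesis by (simp add: set_lebesgue_integral_def mult.commute)
  qed
  have gset: "set_integrable lborel A g" if "A \<in> sets borel" for A
    using g that unfolding set_integrable_def by (intro integrable_mult_indicator) auto
  have all: "(LINT x:A|lborel. g x) = 0" if "A \<in> sets borel" for A
  proof -
    have sb: "sigma_sets UNIV (Collect closed) = sets (borel :: (real^'d) measure)"
      by (simp add: borel_eq_closed sets_measure_of_conv)
    have "Int_stable (Collect closed :: (real^'d) set set)" by (auto simp: Int_stable_def)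
    moreover have "Collect closed \<subseteq> Pow (UNIV :: (real^'d) set)" by simp
    moreover have "A \<in> sigma_sets UNIV (Collect closed)" using that by (simp add: sb)
    ultimately show ?thesis
    proof (induction rule: sigma_sets_induct_disjoint)
      case (compl A)
      have "(LINT x:UNIV|lborel. g x) = (LINT x:(A \<union> (UNIV - A))|lborel. g x)" by simp
      also have "\<dots> = (LINT x:A|lborel. g x) + (LINT x:UNIV - A|lborel. g x)"
        using compl sb by (intro set_integral_Un gset) auto
      finally show ?case using compl closed[of UNIV] by simp
    next
      case (union A)
      have Ai: "A i \<in> sets borel" for i using union(2) unfolding sb by auto
      have "(LINT x:(\<Union>i. A i)|lborel. g x) = (\<Sum>i. (LINT x:A i|lborel. g x))"
      proof (rule lebesgue_integral_countable_add)
        show "set_integrable lborel (\<Union>i. A i) g" by (intro gset sets.countable_UN) (use Ai in auto)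
        show "A i \<inter> A j = {}" if "i \<noteq> j" for i j
          using union(1) that by (auto simp: disjoint_family_on_def)
      qed (use Ai in auto)
      then show ?case using union(3) by simp
    next
      case (basic A)
      then show ?case using closed by simp
    qed (simp add: set_lebesgue_integral_def)
  qed
  have "AE x in lborel. g x = 0"
    by (rule sigma_finite_measure.density_zero[OF sigma_finite_lborel g]) (simp add: all)
  then show ?thesis by eventually_elim (auto simp: g_def)
qed

section \<open>Integration by parts on the torus\<close>

lemma cell_measurable [measurable]: "cell L \<in> sets borel"
  by (simp add: cell_def)

lemma set_integrable_cell:
  fixes f :: "real^'d::finite \<Rightarrow> 'b::euclidean_space"
  assumes "continuous_on UNIV f"
  shows "set_integrable lborel (cell L) f"
proof -
  have "set_integrable lborel (cbox 0 (\<chi> i. L)) f"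
    unfolding set_integrable_def
    by (intro borel_integrable_compact continuous_on_subset[OF assms]) auto
  then show ?thesis by (rule set_integrable_subset) (auto simp: cell_subset_cbox)
qed

lemma lborel_integral_translate:
  fixes F :: "'a::euclidean_space \<Rightarrow> real"
  assumes "F \<in> borel_measurable borel"
  shows "(\<integral>x. F (x + c) \<partial>lborel) = (\<integral>x. F x \<partial>lborel)"
proof -
  have "(\<integral>x. F x \<partial>lborel) = (\<integral>x. F x \<partial>distr lborel borel ((+) c))" by (simp add: lborel_distr_plus)
  also have "\<dots> = (\<integral>x. F (c + x) \<partial>lborel)" by (rule integral_distr) (use assms in auto)
  finally show ?thesis by (simp add: add.commute)
qed

lemma integral_cell_translate:
  fixes h :: "real^'d::finite \<Rightarrow> real"
  assumes h: "continuous_on UNIV h" and per: "periodic L h" and t: "0 \<le> t" "t \<le> L"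
  shows "(LINT x:cell L|lborel. h (x + t *\<^sub>R axis i 1)) = (LINT x:cell L|lborel. h x)"
proof -
  have hm [measurable]: "h \<in> borel_measurable borel" by (rule borel_measurable_continuous_onI[OF h])
  define S where "S lo hi = {x::real^'d. (\<forall>j. j \<noteq> i \<longrightarrow> 0 < x $ j \<and> x $ j < L) \<and> lo \<le> x $ i \<and> x $ i < hi}" for lo hi
  have Sm [measurable]: "S lo hi \<in> sets borel" for lo hi
  proof -
    have "S lo hi = (\<Inter>j\<in>UNIV - {i}. {x. 0 < x $ j} \<inter> {x. x $ j < L}) \<inter> {x. lo \<le> x $ i} \<inter> {x. x $ i < hi}"
      by (auto simp: S_def)
    also have "\<dots> \<in> sets borel"
    proof (intro sets.Int)
      show "(\<Inter>j\<in>UNIV - {i}. {x::real^'d. 0 < x $ j} \<inter> {x. x $ j < L}) \<in> sets borel"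
        by (intro borel_open open_INT ballI open_Int open_Collect_less continuous_intros) auto
    qed (intro borel_open borel_closed open_Collect_less closed_Collect_le continuous_intros)+
    finally show ?thesis .
  qed
  have Si: "set_integrable lborel (S lo hi) h" for lo hi
  proof -
    define a b :: "real^'d" where "a = (\<chi> j. min 0 lo)" and "b = (\<chi> j. max L hi)"
    have "set_integrable lborel (cbox a b) h"
      unfolding set_integrable_def
      by (intro borel_integrable_compact continuous_on_subset[OF h]) auto
    moreover have "S lo hi \<subseteq> cbox a b"
    proof
      fix x assume x: "x \<in> S lo hi"
      have "a $ j \<le> x $ j \<and> x $ j \<le> b $ j" for j
        using x by (cases "j = i") (auto simp: S_def a_def b_def min_le_iff_disj le_max_iff_disj less_imp_le)
      then show "x \<in> cbox a b" by (simp add: mem_box_cart)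
    qed
    ultimately show ?thesis using set_integrable_subset by force
  qed
  have shift: "(LINT x:S lo hi|lborel. h (x + s *\<^sub>R axis i 1)) = (LINT x:S (lo + s) (hi + s)|lborel. h x)"
    for lo hi s
  proof -
    have "indicator (S lo hi) x = (indicator (S (lo + s) (hi + s)) (x + s *\<^sub>R axis i 1) :: real)" for x
      by (auto simp: S_def indicator_def axis_def)
    then show ?thesis
      unfolding set_lebesgue_integral_def
      by (simp add: lborel_integral_translate[where F="\<lambda>x. indicator (S (lo + s) (hi + s)) x *\<^sub>R h x", simplified])
  qed
  have split: "(LINT x:S a c|lborel. h x) = (LINT x:S a b|lborel. h x) + (LINT x:S b c|lborel. h x)"
    if "a \<le> b" "b \<le> c" for a b c
  proof -
    have disj: "S a b \<inter> S b c = {}" by (auto simp: S_def)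
    have "S a c = S a b \<union> S b c" using that by (auto simp: S_def)
    then show ?thesis
      using set_integral_Un[of "S a b" "S b c" lborel h, OF _ Si Si] by (simp add: disj)
  qed
  have cellS: "(LINT x:cell L|lborel. f x) = (LINT x:S 0 L|lborel. f x)"
    if [measurable]: "f \<in> borel_measurable borel" for f :: "real^'d \<Rightarrow> real"
  proof -
    have "AE x in lborel. x \<bullet> (axis i 1 :: real^'d) \<noteq> 0"
      by (rule AE_lborel_inner_neq) (simp add: axis_in_Basis_iff)
    then have "AE x in lborel. indicator (cell L) x *\<^sub>R f x = indicator (S 0 L) x *\<^sub>R f x"
    proof eventually_elim
      case (elim x)
      then have ne: "x $ i \<noteq> 0" by (simp add: inner_axis)
      have "x \<in> cell L \<longleftrightarrow> x \<in> S 0 L"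
      proof
        assume "x \<in> S 0 L"
        then have "0 < x $ j \<and> x $ j < L" for j using ne by (cases "j = i") (auto simp: S_def)
        then show "x \<in> cell L" by (simp add: cell_def mem_box_cart)
      qed (auto simp: S_def cell_def mem_box_cart less_imp_le)
      then show ?case by (simp add: indicator_def)
    qed
    then show ?thesis
      unfolding set_lebesgue_integral_def by (intro integral_cong_AE) auto
  qed
  have "(LINT x:cell L|lborel. h (x + t *\<^sub>R axis i 1)) = (LINT x:S 0 L|lborel. h (x + t *\<^sub>R axis i 1))"
    by (rule cellS) simp
  also have "\<dots> = (LINT x:S t (L + t)|lborel. h x)" using shift[of 0 L t] by simp
  also have "\<dots> = (LINT x:S t L|lborel. h x) + (LINT x:S L (L + t)|lborel. h x)"
    using t by (intro split) auto
  also have "(LINT x:S L (L + t)|lborel. h x) = (LINT x:S 0 t|lborel. h x)"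
    using shift[of 0 t L] per by (simp add: periodic_def add.commute)
  also have "(LINT x:S t L|lborel. h x) + (LINT x:S 0 t|lborel. h x) = (LINT x:S 0 L|lborel. h x)"
    using split[of 0 t L] t by simp
  also have "\<dots> = (LINT x:cell L|lborel. h x)" by (rule cellS[symmetric]) simp
  finally show ?thesis .
qed

text \<open>
  The difference quotients of \<open>h\<close> have integral zero by translation invariance; they converge
  boundedly to \<open>g\<close>.
\<close>

lemma integral_cell_deriv_eq_0:
  fixes h g :: "real^'d::finite \<Rightarrow> real"
  assumes "0 < L" and h: "continuous_on UNIV h" and g: "continuous_on UNIV g" and per: "periodic L h"
    and deriv: "\<And>x t. ((\<lambda>t. h (x + t *\<^sub>R axis i 1)) has_real_derivative g (x + t *\<^sub>R axis i 1)) (at t)"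
  shows "(LINT x:cell L|lborel. g x) = 0"
proof -
  have hm [measurable]: "h \<in> borel_measurable borel" by (rule borel_measurable_continuous_onI[OF h])
  have gm [measurable]: "g \<in> borel_measurable borel" by (rule borel_measurable_continuous_onI[OF g])
  define s where "s n = L / real (Suc n)" for n
  have s: "0 < s n" "s n \<le> L" for n
    using \<open>0 < L\<close> by (auto simp: s_def divide_le_eq)
  have s0: "s \<longlonglongrightarrow> 0"
    unfolding s_def by (rule LIMSEQ_Suc) (rule lim_const_over_n)
  define D where "D n x = (h (x + s n *\<^sub>R axis i 1) - h x) / s n" for n x
  define K :: "(real^'d) set" where "K = cbox 0 (\<chi> j. 2 * L)"
  have "bounded (g ` K)"
    unfolding K_def by (intro compact_imp_bounded compact_continuous_image continuous_on_subset[OF g]) auto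
  then obtain C where C: "\<And>y. y \<in> K \<Longrightarrow> \<bar>g y\<bar> \<le> C" by (auto simp: bounded_iff)
  have D0: "(LINT x:cell L|lborel. D n x) = 0" for n
  proof -
    have c: "continuous_on UNIV (\<lambda>x. h (x + s n *\<^sub>R axis i 1))"
      by (intro continuous_on_compose2[OF h] continuous_intros) auto
    have "(LINT x:cell L|lborel. h (x + s n *\<^sub>R axis i 1) - h x) = 0"
      using integral_cell_translate[OF h per less_imp_le[OF s(1)] s(2), of n i]
      by (simp add: set_integral_diff(2)[OF set_integrable_cell[OF c] set_integrable_cell[OF h]])
    then show ?thesis by (simp add: D_def)
  qed
  have Db: "\<bar>D n x\<bar> \<le> C" if x: "x \<in> cell L" for n x
  proof -
    obtain z where z: "0 < z" "z < s n" and "h (x + s n *\<^sub>R axis i 1) - h (x + 0 *\<^sub>R axis i 1) = (s n - 0) * g (x + z *\<^sub>R axis i 1)"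
      using MVT2[of 0 "s n" "\<lambda>t. h (x + t *\<^sub>R axis i 1)" "\<lambda>t. g (x + t *\<^sub>R axis i 1)"] deriv s by blast
    then have "D n x = g (x + z *\<^sub>R axis i 1)" using s(1)[of n] by (simp add: D_def)
    moreover have "x + z *\<^sub>R axis i 1 \<in> K"
      unfolding K_def mem_box_cart
    proof
      fix j
      have "0 < x $ j" "x $ j < L" using x by (auto simp: cell_def mem_box_cart)
      then show "0 $ j \<le> (x + z *\<^sub>R axis i 1) $ j \<and> (x + z *\<^sub>R axis i 1) $ j \<le> (\<chi> j. 2 * L) $ j"
        using z s(2)[of n] by (auto simp: axis_def)
    qed
    ultimately show ?thesis using C by simp
  qed
  have Dlim: "(\<lambda>n. D n x) \<longlonglongrightarrow> g x" for x
  proof -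
    have "((\<lambda>t. (h (x + t *\<^sub>R axis i 1) - h x) / t) \<longlongrightarrow> g x) (at 0)"
      using deriv[of x 0] by (simp add: has_field_derivative_iff)
    moreover have "filterlim s (at 0) sequentially"
      using s0 s(1) by (auto simp: filterlim_at less_imp_neq[symmetric] intro!: always_eventually)
    ultimately show ?thesis
      unfolding D_def by (rule filterlim_compose)
  qed
  have "(\<lambda>n. LINT x:cell L|lborel. D n x) \<longlonglongrightarrow> (LINT x:cell L|lborel. g x)"
    unfolding set_lebesgue_integral_def
  proof (rule integral_dominated_convergence[where w="\<lambda>x. indicator (cell L) x * C"])
    show "integrable lborel (\<lambda>x. indicator (cell L) x * C)"
      using set_integrable_cell[of "\<lambda>x. C"] by (simp add: set_integrable_def)
    show "AE x in lborel. (\<lambda>n. indicator (cell L) x *\<^sub>R D n x) \<longlonglongrightarrow> indicator (cell L) x *\<^sub>R g x"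
      by (intro AE_I2 tendsto_intros Dlim)
    show "AE x in lborel. norm (indicator (cell L) x *\<^sub>R D n x) \<le> indicator (cell L) x * C" for n
      by (intro AE_I2) (auto simp: indicator_def Db)
  qed (auto simp: D_def)
  then show ?thesis by (simp add: D0 LIMSEQ_const_iff)
qed

lemma pd_has_real_derivative:
  assumes "\<phi> differentiable_on UNIV"
  shows "((\<lambda>t. \<phi> (x + t *\<^sub>R axis i 1)) has_real_derivative pd i \<phi> (x + t *\<^sub>R axis i 1)) (at t)"
proof -
  let ?y = "x + t *\<^sub>R axis i 1" and ?f' = "frechet_derivative \<phi> (at (x + t *\<^sub>R axis i 1))"
  have f': "(\<phi> has_derivative ?f') (at ?y)"
    using assms by (simp add: differentiable_on_def frechet_derivative_works)
  have "((\<lambda>t. x + t *\<^sub>R axis i 1) has_derivative (\<lambda>s. s *\<^sub>R axis i 1)) (at t)"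
    by (auto intro!: derivative_eq_intros)
  from has_derivative_compose[OF this f']
  have "((\<lambda>t. \<phi> (x + t *\<^sub>R axis i 1)) has_derivative (\<lambda>s. ?f' (s *\<^sub>R axis i 1))) (at t)" .
  moreover have "?f' (s *\<^sub>R axis i 1) = pd i \<phi> ?y * s" for s
    using linear_scale[OF has_derivative_linear[OF f']] by (simp add: pd_def)
  ultimately show ?thesis by (simp add: has_field_derivative_def)
qed

lemma wave_shift: "wave L n (a + pi/2) x = - sin (freq L n \<bullet> x + a)"
  by (simp add: wave_def cos_add sin_add algebra_simps)

lemma wave_has_derivative:
  "((\<lambda>x. c * wave L n a x) has_derivative (\<lambda>h. c * (wave L n (a + pi/2) x * (freq L n \<bullet> h)))) (at x)"
  unfolding wave_shift unfolding wave_def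
  by (auto intro!: derivative_eq_intros simp: algebra_simps)

lemma wave_differentiable: "(\<lambda>x. c * wave L n a x) differentiable_on UNIV"
  unfolding differentiable_on_def
  by (intro ballI differentiableI[OF wave_has_derivative])

lemma pd_wave: "pd i (\<lambda>x. c * wave L n a x) = (\<lambda>x. (c * freq L n $ i) * wave L n (a + pi/2) x)"
proof
  fix x
  have "frechet_derivative (\<lambda>x. c * wave L n a x) (at x) = (\<lambda>h. c * (wave L n (a + pi/2) x * (freq L n \<bullet> h)))"
    by (rule frechet_derivative_at[OF wave_has_derivative, symmetric])
  then show "pd i (\<lambda>x. c * wave L n a x) x = (c * freq L n $ i) * wave L n (a + pi/2) x"
    by (simp add: pd_def inner_axis)
qed

lemma pd_wave1: "pd i (wave L n a) x = freq L n $ i * wave L n (a + pi/2) x"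
  using pd_wave[of i 1 L n a] by simp

lemma smooth_wave: "smooth (wave L n a)"
proof -
  have "Ck m (\<lambda>x. c * wave L n a x)" for m c a
  proof (induction m arbitrary: c a)
    case 0 then show ?case by (auto intro!: continuous_intros continuous_on_wave)
  next
    case (Suc m)
    then show ?case by (simp add: pd_wave wave_differentiable)
  qed
  from this[of _ 1 a] show ?thesis by (simp add: smooth_def)
qed

lemma periodic_wave:
  assumes "L \<noteq> 0"
  shows "periodic L (wave L n a)"
  unfolding periodic_def
proof (intro allI)
  fix x i
  have "freq L n \<bullet> (x + L *\<^sub>R axis i 1) + a = (freq L n \<bullet> x + a) + 2 * pi * of_int (n i)"
    using assms by (simp add: inner_add_right inner_axis freq_def)
  then have "wave L n a (x + L *\<^sub>R axis i 1) = cos ((freq L n \<bullet> x + a) + 2 * pi * of_int (n i))"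
    by (simp only: wave_def)
  also have "\<dots> = cos (freq L n \<bullet> x + a)"
    by (subst cos_add) (simp add: cos_int_2pin sin_int_2pin)
  finally show "wave L n a (x + L *\<^sub>R axis i 1) = wave L n a x"
    by (simp only: wave_def)
qed

lemma wave_in_test_per: "L \<noteq> 0 \<Longrightarrow> wave L n a \<in> test_per L"
  by (simp add: test_per_def smooth_wave periodic_wave)

lemma integral_wave:
  assumes "0 < L" and "n \<noteq> (\<lambda>i. 0)"
  shows "(LINT x:cell L|lborel. wave L n a x) = 0"
proof -
  obtain i where "n i \<noteq> 0" using assms by auto
  then have i: "freq L n $ i \<noteq> 0" using \<open>0 < L\<close> by (simp add: freq_def)
  have "(LINT x:cell L|lborel. freq L n $ i * wave L n (a - pi/2 + pi/2) x) = 0"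
    unfolding pd_wave1[symmetric]
  proof (rule integral_cell_deriv_eq_0[OF \<open>0 < L\<close>, where h="wave L n (a - pi/2)" and i=i])
    show "continuous_on UNIV (pd i (wave L n (a - pi/2)))"
      unfolding pd_wave1[abs_def] by (intro continuous_intros continuous_on_wave)
    show "((\<lambda>t. wave L n (a - pi/2) (x + t *\<^sub>R axis i 1)) has_real_derivative
        pd i (wave L n (a - pi/2)) (x + t *\<^sub>R axis i 1)) (at t)" for x t
      using wave_differentiable[of 1] by (intro pd_has_real_derivative) simp
  qed (use assms in \<open>auto intro: continuous_on_wave periodic_wave\<close>)
  then show ?thesis using i by simp
qed

lemma wave_by_parts:
  fixes \<psi> :: "real^'d::finite \<Rightarrow> real"
  assumes "0 < L" and \<psi>: "\<psi> \<in> test_per L"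
  shows "(LINT x:cell L|lborel. pd i \<psi> x * wave L n a x) =
    - (LINT x:cell L|lborel. \<psi> x * (freq L n $ i * wave L n (a + pi/2) x))"
proof -
  have "Ck 1 \<psi>" "periodic L \<psi>" using \<psi> by (auto simp: test_per_def smooth_def)
  then have d: "\<psi> differentiable_on UNIV" and c': "continuous_on UNIV (pd i \<psi>)" by auto
  have c: "continuous_on UNIV \<psi>" by (rule differentiable_imp_continuous_on[OF d])
  have dw: "wave L n a differentiable_on UNIV"
    using wave_differentiable[of 1] by simp
  have 1: "continuous_on UNIV (\<lambda>x. pd i \<psi> x * wave L n a x)"
    by (intro continuous_intros c' continuous_on_wave)
  have 2: "continuous_on UNIV (\<lambda>x. \<psi> x * (freq L n $ i * wave L n (a + pi/2) x))"
    by (intro continuous_intros c continuous_on_wave)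
  have "(LINT x:cell L|lborel. pd i \<psi> x * wave L n a x + \<psi> x * (freq L n $ i * wave L n (a + pi/2) x)) = 0"
  proof (rule integral_cell_deriv_eq_0[OF \<open>0 < L\<close>, where h="\<lambda>x. \<psi> x * wave L n a x" and i=i])
    show "continuous_on UNIV (\<lambda>x. \<psi> x * wave L n a x)" by (intro continuous_intros c continuous_on_wave)
    show "periodic L (\<lambda>x. \<psi> x * wave L n a x)"
      using \<open>periodic L \<psi>\<close> periodic_wave[of L n a] \<open>0 < L\<close> by (simp add: periodic_def)
    show "((\<lambda>t. \<psi> (x + t *\<^sub>R axis i 1) * wave L n a (x + t *\<^sub>R axis i 1)) has_real_derivative
      pd i \<psi> (x + t *\<^sub>R axis i 1) * wave L n a (x + t *\<^sub>R axis i 1) +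
      \<psi> (x + t *\<^sub>R axis i 1) * (freq L n $ i * wave L n (a + pi/2) (x + t *\<^sub>R axis i 1))) (at t)" for x t
      using DERIV_mult[OF pd_has_real_derivative[OF d, of x i t] pd_has_real_derivative[OF dw, of x i t]]
      by (simp add: pd_wave1 algebra_simps)
  qed (intro continuous_on_add 1 2)
  then show ?thesis
    using set_integral_add(2)[OF set_integrable_cell[OF 1] set_integrable_cell[OF 2], of L] by simp
qed

section \<open>Lebesgue and Sobolev spaces\<close>

lemma set_integral_inner_left:
  fixes f :: "'a \<Rightarrow> 'b::euclidean_space"
  assumes "set_integrable M A f"
  shows "(LINT x:A|M. f x \<bullet> c) = (LINT x:A|M. f x) \<bullet> c"
  using integral_inner_left[of c M "\<lambda>x. indicator A x *\<^sub>R f x"] assms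
  by (simp add: set_lebesgue_integral_def set_integrable_def)

lemma set_integral_scaleR_const:
  fixes v :: "'b::euclidean_space"
  assumes "set_integrable M A f"
  shows "(LINT x:A|M. f x *\<^sub>R v) = (LINT x:A|M. f x) *\<^sub>R v"
  using integral_scaleR_left[of v M "\<lambda>x. indicator A x *\<^sub>R f x"] assms
  by (simp add: set_lebesgue_integral_def set_integrable_def)

lemma L2_measurable: "f \<in> L2 D \<Longrightarrow> f \<in> borel_measurable borel"
  by (simp add: L2_def)

lemma L2per_L2: "f \<in> L2per L \<Longrightarrow> f \<in> L2 (cell L)"
  by (simp add: L2per_def)

lemma L2_integrable_inner:
  fixes f g :: "real^'d::finite \<Rightarrow> 'b::euclidean_space"
  assumes f: "f \<in> L2 D" and g: "g \<in> L2 D" and [measurable]: "D \<in> sets borel"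
  shows "set_integrable lborel D (\<lambda>x. f x \<bullet> g x)"
proof -
  note [measurable] = L2_measurable[OF f] L2_measurable[OF g]
  have "set_integrable lborel D (\<lambda>x. (norm (f x))\<^sup>2 + (norm (g x))\<^sup>2)"
    using f g by (intro set_integral_add) (auto simp: L2_def)
  then show ?thesis
  proof (rule set_integrable_bound)
    show "set_borel_measurable lborel D (\<lambda>x. f x \<bullet> g x)" unfolding set_borel_measurable_def by measurable
    have "\<bar>f x \<bullet> g x\<bar> \<le> (norm (f x))\<^sup>2 + (norm (g x))\<^sup>2" for x
    proof -
      have "\<bar>f x \<bullet> g x\<bar> \<le> norm (f x) * norm (g x)" by (rule Cauchy_Schwarz_ineq2)
      also have "\<dots> \<le> (norm (f x))\<^sup>2 + (norm (g x))\<^sup>2"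
        using sum_squares_bound[of "norm (f x)" "norm (g x)"]
          mult_nonneg_nonneg[OF norm_ge_zero norm_ge_zero, of "f x" "g x"]
        by linarith
      finally show ?thesis .
    qed
    then show "AE x in lborel. x \<in> D \<longrightarrow> norm (f x \<bullet> g x) \<le> norm ((norm (f x))\<^sup>2 + (norm (g x))\<^sup>2)"
      by (auto intro!: AE_I2)
  qed
qed

lemma subspace_L2:
  assumes [measurable]: "D \<in> sets borel"
  shows "subspace (L2 D :: (real^'d::finite \<Rightarrow> 'b::euclidean_space) set)"
proof (rule subspaceI)
  show "0 \<in> (L2 D :: (real^'d \<Rightarrow> 'b) set)" by (simp add: L2_def set_integrable_def zero_fun_def)
next
  fix f g :: "real^'d \<Rightarrow> 'b" assume f: "f \<in> L2 D" and g: "g \<in> L2 D"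
  note [measurable] = L2_measurable[OF f] L2_measurable[OF g]
  have "set_integrable lborel D (\<lambda>x. f x \<bullet> f x + 2 * (f x \<bullet> g x) + g x \<bullet> g x)"
    by (intro set_integral_add set_integrable_mult_right L2_integrable_inner f g) auto
  moreover have "(norm ((f + g) x))\<^sup>2 = f x \<bullet> f x + 2 * (f x \<bullet> g x) + g x \<bullet> g x" for x
    by (simp add: power2_norm_eq_inner inner_add_left inner_add_right inner_commute)
  ultimately show "f + g \<in> L2 D" by (simp add: L2_def plus_fun_def)
next
  fix f :: "real^'d \<Rightarrow> 'b" and c assume f: "f \<in> L2 D"
  note [measurable] = L2_measurable[OF f]
  have "set_integrable lborel D (\<lambda>x. c\<^sup>2 * (norm (f x))\<^sup>2)"
    using f by (intro set_integrable_mult_right) (simp add: L2_def)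
  then show "c *\<^sub>R f \<in> L2 D" by (simp add: L2_def scaleR_fun_def power_mult_distrib)
qed

lemma ip_lincomb:
  fixes f g h :: "real^'d::finite \<Rightarrow> 'b::euclidean_space"
  assumes "f \<in> L2 D" "g \<in> L2 D" "h \<in> L2 D" "D \<in> sets borel"
  shows "ip D (a *\<^sub>R f + b *\<^sub>R g) h = a * ip D f h + b * ip D g h"
  using set_integral_add(2)[OF set_integrable_mult_right[OF L2_integrable_inner[OF assms(1,3,4)], of a]
      set_integrable_mult_right[OF L2_integrable_inner[OF assms(2,3,4)], of b]]
  by (simp add: ip_def scaleR_fun_def inner_add_left)

lemma ip_commute: "ip D f g = ip D g f"
  by (simp add: ip_def inner_commute)

lemma ip_self_nonneg: "0 \<le> ip D f f"
  unfolding ip_def set_lebesgue_integral_def by (intro integral_nonneg_AE) (auto intro!: AE_I2)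

lemma L2norm_sq: "(L2norm D f)\<^sup>2 = ip D f f"
  by (simp add: L2norm_def ip_self_nonneg)

lemma L2norm_nonneg: "0 \<le> L2norm D f"
  by (simp add: L2norm_def ip_self_nonneg)

lemma ip_Cauchy_Schwarz:
  fixes f g :: "real^'d::finite \<Rightarrow> 'b::euclidean_space"
  assumes f: "f \<in> L2 D" and g: "g \<in> L2 D" and D: "D \<in> sets borel"
  shows "\<bar>ip D f g\<bar> \<le> L2norm D f * L2norm D g"
proof -
  let ?A = "ip D f f" and ?B = "ip D f g" and ?C = "ip D g g"
  have q: "0 \<le> ?A + 2 * t * ?B + t\<^sup>2 * ?C" for t
  proof -
    have m: "1 *\<^sub>R f + t *\<^sub>R g \<in> L2 D"
      using subspace_L2[OF D] f g by (intro subspace_add subspace_scale)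
    have "ip D (1 *\<^sub>R f + t *\<^sub>R g) (1 *\<^sub>R f + t *\<^sub>R g) = 1 * ip D f (1 *\<^sub>R f + t *\<^sub>R g) + t * ip D g (1 *\<^sub>R f + t *\<^sub>R g)"
      by (rule ip_lincomb[OF f g m D])
    also have "\<dots> = ?A + 2 * t * ?B + t\<^sup>2 * ?C"
      using ip_lincomb[OF f g f D, of 1 t] ip_lincomb[OF f g g D, of 1 t]
      by (simp add: ip_commute[of D _ "_ + _"] ip_commute[of D g f] algebra_simps power2_eq_square)
    finally show ?thesis using ip_self_nonneg by metis
  qed
  have "?B\<^sup>2 \<le> ?A * ?C"
  proof (cases "?C = 0")
    case True
    have "?B = 0"
    proof (rule ccontr)
      assume "?B \<noteq> 0"
      then show False using q[of "- (?A + 1) / (2 * ?B)"] True by (simp add: field_simps)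
    qed
    then show ?thesis using True by simp
  next
    case False
    then have C: "?C > 0" using ip_self_nonneg[of D g] by simp
    have "0 \<le> ?C * (?A + 2 * (- ?B / ?C) * ?B + (- ?B / ?C)\<^sup>2 * ?C)"
      using q[of "- ?B / ?C"] C by (intro mult_nonneg_nonneg) auto
    then show ?thesis using C by (simp add: field_simps power2_eq_square)
  qed
  also have "\<dots> = (L2norm D f * L2norm D g)\<^sup>2" by (simp add: power_mult_distrib L2norm_sq)
  finally show ?thesis
    by (simp add: L2norm_nonneg flip: abs_le_square_iff)
qed

lemma L2_set_integrable:
  fixes f :: "real^'d::finite \<Rightarrow> 'b::euclidean_space"
  assumes f: "f \<in> L2 (cell L)"
  shows "set_integrable lborel (cell L) f"
proof -
  note [measurable] = L2_measurable[OF f]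
  have "set_integrable lborel (cell L) (\<lambda>x. 1 + (norm (f x))\<^sup>2)"
    using f by (intro set_integral_add set_integrable_cell[of "\<lambda>x. 1"]) (auto simp: L2_def)
  then show ?thesis
  proof (rule set_integrable_bound)
    show "set_borel_measurable lborel (cell L) f" unfolding set_borel_measurable_def by measurable
    have "norm (f x) \<le> 1 + (norm (f x))\<^sup>2" for x
      using sum_squares_bound[of 1 "norm (f x)"] norm_ge_zero[of "f x"]
      unfolding one_power2 mult_1_right by linarith
    then show "AE x in lborel. x \<in> cell L \<longrightarrow> norm (f x) \<le> norm (1 + (norm (f x))\<^sup>2)"
      by (auto intro!: AE_I2)
  qed
qed

lemma set_integrable_scaleR_cell:
  fixes f :: "real^'d::finite \<Rightarrow> 'b::euclidean_space"
  assumes f: "f \<in> L2 (cell L)" and \<psi>: "continuous_on UNIV \<psi>"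
  shows "set_integrable lborel (cell L) (\<lambda>x. \<psi> x *\<^sub>R f x)"
proof -
  note [measurable] = L2_measurable[OF f] borel_measurable_continuous_onI[OF \<psi>]
  have "bounded (\<psi> ` cbox 0 (\<chi> i. L))"
    by (intro compact_imp_bounded compact_continuous_image continuous_on_subset[OF \<psi>]) auto
  then obtain C where C: "\<And>x. x \<in> cell L \<Longrightarrow> \<bar>\<psi> x\<bar> \<le> C"
    using cell_subset_cbox by (fastforce simp: bounded_iff)
  have "set_integrable lborel (cell L) (\<lambda>x. C *\<^sub>R f x)"
    using L2_set_integrable[OF f] by (intro set_integrable_scaleR_right)
  then show ?thesis
  proof (rule set_integrable_bound)
    show "set_borel_measurable lborel (cell L) (\<lambda>x. \<psi> x *\<^sub>R f x)" unfolding set_borel_measurable_def by measurable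
    show "AE x in lborel. x \<in> cell L \<longrightarrow> norm (\<psi> x *\<^sub>R f x) \<le> norm (C *\<^sub>R f x)"
      using order_trans[OF C abs_ge_self] by (auto intro!: AE_I2 mult_right_mono)
  qed
qed

lemma subspace_L2per: "subspace (L2per L :: (real^'d::finite \<Rightarrow> 'b::euclidean_space) set)"
proof (rule subspaceI)
  show "0 \<in> (L2per L :: (real^'d \<Rightarrow> 'b) set)"
    using subspace_0[OF subspace_L2[of "cell L :: (real^'d) set"]] by (simp add: L2per_def periodic_def set_lebesgue_integral_def)
next
  fix f g :: "real^'d \<Rightarrow> 'b" assume f: "f \<in> L2per L" and g: "g \<in> L2per L"
  then show "f + g \<in> L2per L"
    using subspace_add[OF subspace_L2[of "cell L :: (real^'d) set"], of f g]
      set_integral_add(2)[OF L2_set_integrable[OF L2per_L2[OF f]] L2_set_integrable[OF L2per_L2[OF g]]]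
    by (simp add: L2per_def periodic_def plus_fun_def)
next
  fix f :: "real^'d \<Rightarrow> 'b" and c assume f: "f \<in> L2per L"
  then show "c *\<^sub>R f \<in> L2per L"
    using subspace_scale[OF subspace_L2[of "cell L :: (real^'d) set"], of f c]
    by (simp add: L2per_def periodic_def scaleR_fun_def)
qed

lemma continuous_in_L2:
  fixes f :: "real^'d::finite \<Rightarrow> 'b::euclidean_space"
  assumes "continuous_on UNIV f"
  shows "f \<in> L2 (cell L)"
  using assms borel_measurable_continuous_onI[OF assms]
  by (auto simp: L2_def intro!: set_integrable_cell continuous_intros)

lemma continuous_on_wave_scaleR:
  fixes v :: "'b::real_normed_vector"
  shows "continuous_on A (\<lambda>x. wave L n a x *\<^sub>R v)"
  by (intro continuous_intros continuous_on_wave)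

lemma wave_scaleR_in_L2per:
  fixes v :: "'b::euclidean_space"
  assumes "0 < L" and "n \<noteq> (\<lambda>i. 0)"
  shows "(\<lambda>x. wave L n a x *\<^sub>R v) \<in> L2per L"
proof -
  have "(LINT x:cell L|lborel. wave L n a x *\<^sub>R v) = 0"
    using set_integral_scaleR_const[OF set_integrable_cell[OF continuous_on_wave], of L L n a v]
      integral_wave[OF assms, of a] by simp
  moreover have "periodic L (\<lambda>x. wave L n a x *\<^sub>R v)"
    using periodic_wave[of L n a] \<open>0 < L\<close> by (simp add: periodic_def)
  ultimately show ?thesis
    using continuous_in_L2[OF continuous_on_wave_scaleR] by (simp add: L2per_def)
qed

lemma test_per_continuous:
  assumes "\<psi> \<in> test_per L"
  shows "continuous_on UNIV \<psi>" "continuous_on UNIV (pd i \<psi>)"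
proof -
  have "Ck 0 \<psi>" "Ck 1 \<psi>" using assms by (auto simp: test_per_def smooth_def)
  then show "continuous_on UNIV \<psi>" "continuous_on UNIV (pd i \<psi>)" by auto
qed

lemma weak_pd_wave:
  fixes v :: "'b::euclidean_space"
  assumes "0 < L"
  shows "weak_pd (cell L) (test_per L) i (\<lambda>x. wave L n a x *\<^sub>R v)
    (\<lambda>x. wave L n (a + pi/2) x *\<^sub>R (freq L n $ i *\<^sub>R v))"
  unfolding weak_pd_def
proof
  fix \<psi> :: "real^'a \<Rightarrow> real" assume \<psi>: "\<psi> \<in> test_per L"
  note c = test_per_continuous[OF \<psi>]
  have "(LINT x:cell L|lborel. pd i \<psi> x *\<^sub>R wave L n a x *\<^sub>R v) = (LINT x:cell L|lborel. pd i \<psi> x * wave L n a x) *\<^sub>R v"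
    using set_integral_scaleR_const[where v=v, OF set_integrable_cell[of "\<lambda>x. pd i \<psi> x * wave L n a x"]]
    by (simp add: continuous_on_mult c continuous_on_wave)
  also have "\<dots> = - ((LINT x:cell L|lborel. \<psi> x * (freq L n $ i * wave L n (a + pi/2) x)) *\<^sub>R v)"
    by (simp add: wave_by_parts[OF \<open>0 < L\<close> \<psi>])
  also have "(LINT x:cell L|lborel. \<psi> x * (freq L n $ i * wave L n (a + pi/2) x)) *\<^sub>R v =
     (LINT x:cell L|lborel. \<psi> x *\<^sub>R wave L n (a + pi/2) x *\<^sub>R (freq L n $ i *\<^sub>R v))"
    using set_integral_scaleR_const[where v=v, OF set_integrable_cell[of "\<lambda>x. \<psi> x * (freq L n $ i * wave L n (a + pi/2) x)"]]
    by (simp add: continuous_on_mult c continuous_on_wave mult.commute mult.left_commute)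
  finally show "(LINT x:cell L|lborel. pd i \<psi> x *\<^sub>R wave L n a x *\<^sub>R v) =
     - (LINT x:cell L|lborel. \<psi> x *\<^sub>R wave L n (a + pi/2) x *\<^sub>R (freq L n $ i *\<^sub>R v))" .
qed

lemma wave_scaleR_in_Hper1:
  fixes v :: "'b::euclidean_space"
  assumes "0 < L" and "n \<noteq> (\<lambda>i. 0)"
  shows "(\<lambda>x. wave L n a x *\<^sub>R v) \<in> Hper L 1"
  unfolding Hper_def One_nat_def sob.simps
  using wave_scaleR_in_L2per[OF assms] weak_pd_wave[OF assms(1)] by blast

lemma zero_if_tests_vanish:
  fixes f :: "real^'d::finite \<Rightarrow> 'b::euclidean_space"
  assumes "0 < L" and f: "f \<in> L2 (cell L)"
    and tests: "\<And>\<psi>. \<psi> \<in> test_per L \<Longrightarrow> (LINT x:cell L|lborel. \<psi> x *\<^sub>R f x) = 0"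
  shows "AE x in lborel. x \<in> cell L \<longrightarrow> f x = 0"
proof -
  have "AE x in lborel. x \<in> cell L \<longrightarrow> f x \<bullet> b = 0" for b
  proof (rule trigonometric_complete[OF \<open>0 < L\<close>])
    show "set_integrable lborel (cell L) (\<lambda>x. f x \<bullet> b)"
      using L2_set_integrable[OF f] integrable_inner_left[of b lborel "\<lambda>x. indicator (cell L) x *\<^sub>R f x"]
      by (simp add: set_integrable_def)
    fix n a
    have "(LINT x:cell L|lborel. f x \<bullet> b * wave L n a x) = (LINT x:cell L|lborel. (wave L n a x *\<^sub>R f x) \<bullet> b)"
      by (simp add: mult.commute)
    also have "\<dots> = 0"
      using \<open>0 < L\<close> by (subst set_integral_inner_left[OF set_integrable_scaleR_cell[OF f continuous_on_wave]])
        (simp add: tests wave_in_test_per)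
    finally show "(LINT x:cell L|lborel. f x \<bullet> b * wave L n a x) = 0" .
  qed
  then have "AE x in lborel. \<forall>b\<in>Basis. x \<in> cell L \<longrightarrow> f x \<bullet> b = 0"
    by (intro AE_finite_allI) auto
  then show ?thesis by eventually_elim (auto intro: euclidean_eqI)
qed

lemma dper_unique:
  fixes v g :: "real^'d::finite \<Rightarrow> 'b::euclidean_space"
  assumes "0 < L" and g: "g \<in> L2per L" and w: "weak_pd (cell L) (test_per L) i v g"
  shows "dper L i v \<in> L2per L" "weak_pd (cell L) (test_per L) i v (dper L i v)"
    "AE x in lborel. x \<in> cell L \<longrightarrow> dper L i v x = g x"
proof -
  have "dper L i v \<in> L2per L \<and> weak_pd (cell L) (test_per L) i v (dper L i v)"
    unfolding dper_def wderiv_def by (rule someI[of _ g]) (use g w in blast)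
  then show d: "dper L i v \<in> L2per L" and wd: "weak_pd (cell L) (test_per L) i v (dper L i v)" by auto
  have "AE x in lborel. x \<in> cell L \<longrightarrow> (dper L i v - g) x = 0"
  proof (rule zero_if_tests_vanish[OF \<open>0 < L\<close>])
    show "dper L i v - g \<in> L2 (cell L)"
      using subspace_diff[OF subspace_L2per d g] by (rule L2per_L2)
    fix \<psi> :: "real^'d \<Rightarrow> real" assume \<psi>: "\<psi> \<in> test_per L"
    note c = test_per_continuous(1)[OF \<psi>]
    have "(LINT x:cell L|lborel. \<psi> x *\<^sub>R (dper L i v - g) x) =
       (LINT x:cell L|lborel. \<psi> x *\<^sub>R dper L i v x) - (LINT x:cell L|lborel. \<psi> x *\<^sub>R g x)"
      using set_integral_diff(2)[OF set_integrable_scaleR_cell[OF L2per_L2[OF d] c] set_integrable_scaleR_cell[OF L2per_L2[OF g] c]]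
      by (simp add: algebra_simps)
    also have "\<dots> = 0"
      using bspec[OF w[unfolded weak_pd_def] \<psi>] bspec[OF wd[unfolded weak_pd_def] \<psi>] by simp
    finally show "(LINT x:cell L|lborel. \<psi> x *\<^sub>R (dper L i v - g) x) = 0" .
  qed
  then show "AE x in lborel. x \<in> cell L \<longrightarrow> dper L i v x = g x"
    by eventually_elim simp
qed

lemma Hper1_dper:
  assumes "0 < L" and "v \<in> Hper L 1"
  shows "dper L i v \<in> L2per L" "weak_pd (cell L) (test_per L) i v (dper L i v)"
proof -
  obtain g where "g \<in> L2per L" "weak_pd (cell L) (test_per L) i v g"
    using assms by (auto simp: Hper_def)
  from dper_unique[OF \<open>0 < L\<close> this] show "dper L i v \<in> L2per L" "weak_pd (cell L) (test_per L) i v (dper L i v)"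
    by auto
qed

section \<open>Gradients of trigonometric functions\<close>

text \<open>Up to a shift of the phase, \<open>gwave L n a\<close> is the gradient of \<open>wave L n a\<close>.\<close>

definition gwave :: "real \<Rightarrow> ('d::finite \<Rightarrow> int) \<Rightarrow> real \<Rightarrow> real^'d \<Rightarrow> real^'d"
  where "gwave L n a = (\<lambda>x. wave L n a x *\<^sub>R freq L n)"

definition no_gradient :: "real \<Rightarrow> (real^'d::finite \<Rightarrow> real^'d) \<Rightarrow> bool"
  where "no_gradient L v \<longleftrightarrow> (\<forall>n a. ip (cell L) v (gwave L n a) = 0)"

lemma gwave_in_L2: "gwave L n a \<in> L2 (cell L)"
  unfolding gwave_def by (rule continuous_in_L2[OF continuous_on_wave_scaleR])

lemma gwave_in_Hper1: "0 < L \<Longrightarrow> n \<noteq> (\<lambda>i. 0) \<Longrightarrow> gwave L n a \<in> Hper L 1"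
  unfolding gwave_def by (rule wave_scaleR_in_Hper1)

lemma no_gradient_lincomb:
  assumes "f \<in> L2 (cell L)" "g \<in> L2 (cell L)" "no_gradient L f" "no_gradient L g"
  shows "no_gradient L (a *\<^sub>R f + b *\<^sub>R g)"
  using assms unfolding no_gradient_def by (simp add: ip_lincomb gwave_in_L2)

lemma V_L2per: "v \<in> V L \<Longrightarrow> v \<in> L2per L"
  by (simp add: V_def Hper_def)

lemma V_no_gradient:
  fixes v :: "real^'d::finite \<Rightarrow> real^'d"
  assumes "0 < L" and "v \<in> V L"
  shows "no_gradient L v"
  unfolding no_gradient_def
proof (intro allI)
  fix n :: "'d \<Rightarrow> int" and a
  have "(\<lambda>x. \<chi> i. pd i (wave L n (a - pi/2)) x) = gwave L n a"
    by (simp add: gwave_def pd_wave1 vec_eq_iff fun_eq_iff)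
  moreover have "ip (cell L) v (\<lambda>x. \<chi> i. pd i (wave L n (a - pi/2)) x) = 0"
    using assms wave_in_test_per[of L n "a - pi/2"] by (auto simp: V_def weakly_div_free_def)
  ultimately show "ip (cell L) v (gwave L n a) = 0" by simp
qed

lemma dper_gwave:
  assumes "0 < L" and "n \<noteq> (\<lambda>i. 0)"
  shows "dper L i (gwave L n a) \<in> L2per L"
    "AE x in lborel. x \<in> cell L \<longrightarrow> dper L i (gwave L n a) x = freq L n $ i *\<^sub>R gwave L n (a + pi/2) x"
proof -
  have w: "weak_pd (cell L) (test_per L) i (gwave L n a) (\<lambda>x. wave L n (a + pi/2) x *\<^sub>R (freq L n $ i *\<^sub>R freq L n))"
    unfolding gwave_def by (rule weak_pd_wave[OF assms(1)])
  note * = dper_unique[OF assms(1) wave_scaleR_in_L2per[OF assms] w]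
  show "dper L i (gwave L n a) \<in> L2per L" by (rule *)
  show "AE x in lborel. x \<in> cell L \<longrightarrow> dper L i (gwave L n a) x = freq L n $ i *\<^sub>R gwave L n (a + pi/2) x"
    using *(3) by eventually_elim (simp add: gwave_def mult.commute)
qed

lemma ip_cong_AE:
  fixes f g h :: "real^'d::finite \<Rightarrow> 'b::euclidean_space"
  assumes "f \<in> L2 D" "g \<in> L2 D" "h \<in> L2 D" and [measurable]: "D \<in> sets borel"
    and "AE x in lborel. x \<in> D \<longrightarrow> g x = h x"
  shows "ip D f g = ip D f h"
proof -
  note [measurable] = L2_measurable[OF assms(1)] L2_measurable[OF assms(2)] L2_measurable[OF assms(3)]
  show ?thesis
    unfolding ip_def set_lebesgue_integral_def
  proof (rule integral_cong_AE)
    show "AE x in lborel. indicator D x *\<^sub>R (f x \<bullet> g x) = indicator D x *\<^sub>R (f x \<bullet> h x)"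
      using assms(5) by eventually_elim (auto simp: indicator_def)
  qed measurable
qed

lemma ip_scaleR_right: "ip D f (\<lambda>x. c *\<^sub>R g x) = c * ip D f g"
  by (simp add: ip_def)

lemma grad_ip_gwave:
  assumes "0 < L" and "n \<noteq> (\<lambda>i. 0)" and v: "v \<in> V L"
  shows "grad_ip L v (gwave L n a) = 0"
proof -
  have Lne: "L \<noteq> 0" using assms(1) by simp
  have vH: "v \<in> Hper L 1" using v by (simp add: V_def)
  have "ip (cell L) (dper L i v) (dper L i (gwave L n a)) = 0" for i
  proof -
    note d = Hper1_dper[OF assms(1) vH, of i]
    let ?\<psi> = "wave L n (a + pi/2)"
    have sc: "(\<lambda>x. c *\<^sub>R gwave L n b x) \<in> L2 (cell L)" for c b
      unfolding gwave_def by (intro continuous_in_L2 continuous_intros continuous_on_wave)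
    have "ip (cell L) (dper L i v) (dper L i (gwave L n a)) =
        ip (cell L) (dper L i v) (\<lambda>x. freq L n $ i *\<^sub>R gwave L n (a + pi/2) x)"
      by (rule ip_cong_AE[OF L2per_L2[OF d(1)] L2per_L2[OF dper_gwave(1)[OF assms(1,2)]] sc _
            dper_gwave(2)[OF assms(1,2)]]) simp
    also have "\<dots> = freq L n $ i * ip (cell L) (dper L i v) (gwave L n (a + pi/2))"
      by (rule ip_scaleR_right)
    also have "ip (cell L) (dper L i v) (gwave L n (a + pi/2)) = (LINT x:cell L|lborel. (?\<psi> x *\<^sub>R dper L i v x) \<bullet> freq L n)"
      by (simp add: ip_def gwave_def)
    also have "\<dots> = (LINT x:cell L|lborel. ?\<psi> x *\<^sub>R dper L i v x) \<bullet> freq L n"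
      by (intro set_integral_inner_left set_integrable_scaleR_cell L2per_L2 d continuous_on_wave)
    also have "(LINT x:cell L|lborel. ?\<psi> x *\<^sub>R dper L i v x) = - (LINT x:cell L|lborel. pd i ?\<psi> x *\<^sub>R v x)"
      using bspec[OF d(2)[unfolded weak_pd_def] wave_in_test_per, of n "a + pi/2"] assms(1) by simp
    also have "- (LINT x:cell L|lborel. pd i ?\<psi> x *\<^sub>R v x) \<bullet> freq L n = - (LINT x:cell L|lborel. (pd i ?\<psi> x *\<^sub>R v x) \<bullet> freq L n)"
      unfolding inner_minus_left
      by (intro arg_cong[where f=uminus] set_integral_inner_left[symmetric] set_integrable_scaleR_cell L2per_L2 V_L2per v
          test_per_continuous(2)[OF wave_in_test_per[OF Lne]])
    also have "(LINT x:cell L|lborel. (pd i ?\<psi> x *\<^sub>R v x) \<bullet> freq L n) = ip (cell L) v (\<lambda>x. freq L n $ i *\<^sub>R gwave L n (a + pi/2 + pi/2) x)"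
      by (simp add: ip_def gwave_def pd_wave1)
    also have "\<dots> = 0"
      unfolding ip_scaleR_right using V_no_gradient[OF assms(1) v] by (simp add: no_gradient_def)
    finally show ?thesis by simp
  qed
  then show ?thesis by (simp add: grad_ip_def)
qed

lemma dvg_gwave:
  assumes "0 < L" and "n \<noteq> (\<lambda>i. 0)"
  shows "AE x in lborel. x \<in> cell L \<longrightarrow> dvg L (gwave L n a) x = (norm (freq L n))\<^sup>2 * wave L n (a + pi/2) x"
proof -
  have "AE x in lborel. \<forall>i\<in>UNIV. x \<in> cell L \<longrightarrow> dper L i (gwave L n a) x = freq L n $ i *\<^sub>R gwave L n (a + pi/2) x"
    using dper_gwave(2)[OF assms] by (intro AE_finite_allI) auto
  then show ?thesis
  proof eventually_elim
    case (elim x)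
    show ?case
    proof
      assume "x \<in> cell L"
      then have "dvg L (gwave L n a) x = (\<Sum>i\<in>UNIV. freq L n $ i * freq L n $ i * wave L n (a + pi/2) x)"
        using elim by (simp add: dvg_def gwave_def ac_simps)
      also have "\<dots> = (norm (freq L n))\<^sup>2 * wave L n (a + pi/2) x"
        by (simp add: power2_norm_eq_inner inner_vec_def sum_distrib_right)
      finally show "dvg L (gwave L n a) x = (norm (freq L n))\<^sup>2 * wave L n (a + pi/2) x" .
    qed
  qed
qed

lemma zero_if_divergence_tests_vanish:
  fixes p :: "real^'d::finite \<Rightarrow> real"
  assumes "0 < L" and p: "p \<in> L2per L"
    and orth: "\<And>n a. n \<noteq> (\<lambda>i. 0) \<Longrightarrow> a \<in> {0, -pi/2} \<Longrightarrow> ip (cell L) (dvg L (gwave L n a)) p = 0"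
  shows "AE x in lborel. x \<in> cell L \<longrightarrow> p x = 0"
proof (rule trigonometric_complete[OF \<open>0 < L\<close> L2_set_integrable[OF L2per_L2[OF p]]])
  note [measurable] = L2_measurable[OF L2per_L2[OF p]]
  fix n :: "'d \<Rightarrow> int" and a :: real assume a: "a \<in> {0, pi/2}"
  show "(LINT x:cell L|lborel. p x * wave L n a x) = 0"
  proof (cases "n = (\<lambda>i. 0)")
    case True
    then show ?thesis using p a by (auto simp: wave_def L2per_def)
  next
    case False
    obtain i where "n i \<noteq> 0" using False by auto
    then have "freq L n \<noteq> 0" using \<open>0 < L\<close> by (auto simp: freq_def vec_eq_iff)
    have comp: "(\<lambda>x. f x $ i) \<in> borel_measurable borel" if "f \<in> borel_measurable borel"
      for f :: "real^'d \<Rightarrow> real^'d" and i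
      by (rule borel_measurable_continuous_on[OF _ that]) (intro continuous_intros)
    have dm [measurable]: "dvg L (gwave L n (a - pi/2)) \<in> borel_measurable borel"
      unfolding dvg_def
      by (intro borel_measurable_sum comp L2_measurable[OF L2per_L2[OF dper_gwave(1)[OF \<open>0 < L\<close> False]]])
    have "a - pi/2 \<in> {0, -pi/2}" using a by auto
    from orth[OF False this] have "0 = ip (cell L) (dvg L (gwave L n (a - pi/2))) p" by (rule sym)
    also have "\<dots> = (LINT x:cell L|lborel. (norm (freq L n))\<^sup>2 * (p x * wave L n a x))"
      unfolding ip_def set_lebesgue_integral_def
    proof (rule integral_cong_AE)
      show "AE x in lborel. indicator (cell L) x *\<^sub>R (dvg L (gwave L n (a - pi/2)) x \<bullet> p x) =
         indicator (cell L) x *\<^sub>R ((norm (freq L n))\<^sup>2 * (p x * wave L n a x))"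
        using dvg_gwave[OF \<open>0 < L\<close> False, of "a - pi/2"]
        by eventually_elim (auto simp: indicator_def)
    qed measurable
    also have "\<dots> = (norm (freq L n))\<^sup>2 * (LINT x:cell L|lborel. p x * wave L n a x)"
      by simp
    finally show ?thesis using \<open>freq L n \<noteq> 0\<close> by simp
  qed
qed

lemma subspace_Hper1: "subspace (Hper L 1 :: (real^'d::finite \<Rightarrow> 'b::euclidean_space) set)"
proof (rule subspaceI)
  have H: "Hper L 1 = {f \<in> L2per L. \<forall>i. \<exists>g\<in>L2per L. weak_pd (cell L) (test_per L) i f (g :: real^'d \<Rightarrow> 'b)}"
    by (simp add: Hper_def)
  have comb: "weak_pd (cell L) (test_per L) i (a *\<^sub>R f + b *\<^sub>R g) (a *\<^sub>R f' + b *\<^sub>R g')"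
    if w: "weak_pd (cell L) (test_per L) i f f'" "weak_pd (cell L) (test_per L) i g g'"
      and m: "f \<in> L2per L" "g \<in> L2per L" "f' \<in> L2per L" "g' \<in> L2per L"
    for i a b and f g f' g' :: "real^'d \<Rightarrow> 'b"
    unfolding weak_pd_def
  proof
    fix \<psi> :: "real^'d \<Rightarrow> real" assume \<psi>: "\<psi> \<in> test_per L"
    note c = test_per_continuous[OF \<psi>]
    have split: "(LINT x:cell L|lborel. k' x *\<^sub>R (a *\<^sub>R h + b *\<^sub>R k) x) =
        a *\<^sub>R (LINT x:cell L|lborel. k' x *\<^sub>R h x) + b *\<^sub>R (LINT x:cell L|lborel. k' x *\<^sub>R k x)"
      if "h \<in> L2per L" "k \<in> L2per L" "continuous_on UNIV k'" for h k :: "real^'d \<Rightarrow> 'b" and k'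
    proof -
      have eq: "(\<lambda>x. k' x *\<^sub>R (a *\<^sub>R h + b *\<^sub>R k) x) = (\<lambda>x. a *\<^sub>R (k' x *\<^sub>R h x) + b *\<^sub>R (k' x *\<^sub>R k x))"
        by (simp add: fun_eq_iff scaleR_fun_def scaleR_add_right mult.commute)
      show ?thesis
        unfolding eq
        by (subst set_integral_add(2))
           (simp_all only: set_integral_scaleR_right set_integrable_scaleR_right
              set_integrable_scaleR_cell[OF L2per_L2[OF that(1)] that(3)]
              set_integrable_scaleR_cell[OF L2per_L2[OF that(2)] that(3)])
    qed
    show "(LINT x:cell L|lborel. pd i \<psi> x *\<^sub>R (a *\<^sub>R f + b *\<^sub>R g) x) = - (LINT x:cell L|lborel. \<psi> x *\<^sub>R (a *\<^sub>R f' + b *\<^sub>R g') x)"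
      unfolding split[OF m(1,2) c(2)] split[OF m(3,4) c(1)]
      using bspec[OF w(1)[unfolded weak_pd_def] \<psi>] bspec[OF w(2)[unfolded weak_pd_def] \<psi>] by simp
  qed
  have lin: "a *\<^sub>R f + b *\<^sub>R g \<in> Hper L 1" if f: "f \<in> Hper L 1" and g: "g \<in> Hper L 1" for a b and f g :: "real^'d \<Rightarrow> 'b"
    unfolding H
  proof (intro CollectI conjI allI)
    show "a *\<^sub>R f + b *\<^sub>R g \<in> L2per L"
      using f[unfolded H] g[unfolded H] by (intro subspace_add subspace_scale subspace_L2per) auto
    fix i
    obtain f' where f': "f' \<in> L2per L" "weak_pd (cell L) (test_per L) i f f'" using f unfolding H by blast
    obtain g' where g': "g' \<in> L2per L" "weak_pd (cell L) (test_per L) i g g'" using g unfolding H by blast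
    show "\<exists>h\<in>L2per L. weak_pd (cell L) (test_per L) i (a *\<^sub>R f + b *\<^sub>R g) h"
    proof
      show "weak_pd (cell L) (test_per L) i (a *\<^sub>R f + b *\<^sub>R g) (a *\<^sub>R f' + b *\<^sub>R g')"
        using f[unfolded H] g[unfolded H] f' g' by (intro comb) auto
      show "a *\<^sub>R f' + b *\<^sub>R g' \<in> L2per L"
        using f' g' by (intro subspace_add subspace_scale subspace_L2per)
    qed
  qed
  show "0 \<in> (Hper L 1 :: (real^'d \<Rightarrow> 'b) set)"
    unfolding H using subspace_0[OF subspace_L2per[of L]]
    by (auto simp: weak_pd_def intro!: bexI[of _ 0])
  show "f + g \<in> Hper L 1" if "f \<in> Hper L 1" "g \<in> Hper L 1" for f g :: "real^'d \<Rightarrow> 'b"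
    using lin[OF that, of 1 1] by simp
  show "c *\<^sub>R f \<in> Hper L 1" if "f \<in> Hper L 1" for c and f :: "real^'d \<Rightarrow> 'b"
    using lin[OF that that, of c 0] by simp
qed

lemma no_gradient_gateaux:
  fixes u v :: "real^'d::finite \<Rightarrow> real^'d"
  assumes "0 < L" and A2: "A2 L G DG D2G" and A4: "A4 L G"
    and u: "u \<in> Hper L 1" and v: "v \<in> Hper L 1"
  shows "DG u v \<in> L2per L" "no_gradient L (DG u v)"
proof -
  have H0: "Hper L 0 = L2per L" by (simp add: Hper_def)
  have N0: "Hnorm L 0 = L2norm (cell L)" by (simp add: Hnorm_def fun_eq_iff)
  have u0: "u \<in> L2per L" and v0: "v \<in> L2per L" using u v by (auto simp: Hper_def)
  have lin: "DG u \<in> lin_maps (L2per L) (L2per L) (\<lambda>v. ennreal (L2norm (cell L) v))"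
    and gat: "gateaux_deriv (L2per L) (\<lambda>v. ennreal (L2norm (cell L) v)) G u (DG u)"
    using A2 u0 unfolding A2_def Let_def by (auto simp: H0 N0)
  show D: "DG u v \<in> L2per L" using lin v0 by (auto simp: lin_maps_def)
  define q where "q h = (1 / h) *\<^sub>R (G (u + h *\<^sub>R v) - G u)" for h :: real
  have "((\<lambda>h. ennreal (L2norm (cell L) (q h - DG u v))) \<longlongrightarrow> ennreal 0) (at 0)"
    using gat v0 unfolding gateaux_deriv_def q_def by simp
  then have lim: "((\<lambda>h. L2norm (cell L) (q h - DG u v)) \<longlongrightarrow> 0) (at 0)"
    by (rule tendsto_ennrealD) (auto simp: L2norm_nonneg)
  have GV: "G (u + h *\<^sub>R v) \<in> V L" for h
    using A4 subspace_add[OF subspace_Hper1 u subspace_scale[OF subspace_Hper1 v]] by (simp add: A4_def)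
  have q: "q h \<in> L2 (cell L) \<and> no_gradient L (q h)" for h
  proof -
    have "q h = (1 / h) *\<^sub>R G (u + h *\<^sub>R v) + (- 1 / h) *\<^sub>R G (u + 0 *\<^sub>R v)"
      by (simp add: q_def scaleR_diff_right)
    moreover have "(1 / h) *\<^sub>R G (u + h *\<^sub>R v) + (- 1 / h) *\<^sub>R G (u + 0 *\<^sub>R v) \<in> L2 (cell L)"
      by (intro subspace_add subspace_scale subspace_L2[OF cell_measurable] L2per_L2 V_L2per GV)
    moreover have "no_gradient L ((1 / h) *\<^sub>R G (u + h *\<^sub>R v) + (- 1 / h) *\<^sub>R G (u + 0 *\<^sub>R v))"
      by (intro no_gradient_lincomb L2per_L2 V_L2per V_no_gradient GV \<open>0 < L\<close>)
    ultimately show ?thesis by simp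
  qed
  show "no_gradient L (DG u v)"
    unfolding no_gradient_def
  proof (intro allI)
    fix n :: "'d \<Rightarrow> int" and a
    let ?g = "gwave L n a"
    have le: "\<bar>ip (cell L) (DG u v) ?g\<bar> \<le> L2norm (cell L) (q h - DG u v) * L2norm (cell L) ?g" for h
    proof -
      have m: "q h - DG u v \<in> L2 (cell L)"
        by (rule subspace_diff[OF subspace_L2[OF cell_measurable] conjunct1[OF q] L2per_L2[OF D]])
      have "ip (cell L) (1 *\<^sub>R q h + (-1) *\<^sub>R DG u v) ?g = 1 * ip (cell L) (q h) ?g + (-1) * ip (cell L) (DG u v) ?g"
        by (rule ip_lincomb[OF conjunct1[OF q] L2per_L2[OF D] gwave_in_L2 cell_measurable])
      then have "ip (cell L) (q h - DG u v) ?g = - ip (cell L) (DG u v) ?g"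
        using q[of h] by (simp add: no_gradient_def)
      then show ?thesis using ip_Cauchy_Schwarz[OF m gwave_in_L2, of n a] by simp
    qed
    have "((\<lambda>h. L2norm (cell L) (q h - DG u v) * L2norm (cell L) ?g) \<longlongrightarrow> 0 * L2norm (cell L) ?g) (at 0)"
      by (intro tendsto_mult lim tendsto_const)
    then have "\<bar>ip (cell L) (DG u v) ?g\<bar> \<le> 0 * L2norm (cell L) ?g"
      by (rule tendsto_lowerbound) (auto simp: le)
    then show "ip (cell L) (DG u v) ?g = 0" by simp
  qed
qed

section \<open>Vanishing of the pressures\<close>

lemma L2norm_eq_0:
  fixes f :: "real^'d::finite \<Rightarrow> 'b::euclidean_space"
  assumes "AE x in lborel. x \<in> D \<longrightarrow> f x = 0"
  shows "L2norm D f = 0"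
proof -
  have "ip D f f = 0"
    unfolding ip_def set_lebesgue_integral_def
    by (rule integral_eq_zero_AE, use assms in eventually_elim) (auto simp: indicator_def)
  then show ?thesis by (simp add: L2norm_def)
qed

lemma AE_eq_0_if_L2norm_eq_0:
  fixes f :: "real^'d::finite \<Rightarrow> 'b::euclidean_space"
  assumes f: "f \<in> L2 D" and D: "D \<in> sets borel" and "L2norm D f = 0"
  shows "AE x in lborel. x \<in> D \<longrightarrow> f x = 0"
proof -
  have "(\<integral>x. indicator D x *\<^sub>R (f x \<bullet> f x) \<partial>lborel) = 0"
    using assms(3) by (simp add: L2norm_def ip_def set_lebesgue_integral_def)
  then have "AE x in lborel. indicator D x *\<^sub>R (f x \<bullet> f x) = 0"
    using L2_integrable_inner[OF f f D] unfolding set_integrable_def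
    by (subst (asm) integral_nonneg_eq_0_iff_AE) auto
  then show ?thesis by eventually_elim (auto simp: indicator_def)
qed

lemma contractive_functional_ip:
  fixes g :: "real^'d::finite \<Rightarrow> 'b::euclidean_space"
  assumes g: "g \<in> L2 (cell L)"
  shows "contractive_functional (L2per L) (L2norm (cell L)) (\<lambda>v. ip (cell L) v g / (1 + L2norm (cell L) g))"
  unfolding contractive_functional_def
proof (intro conjI ballI allI)
  have pos: "0 < 1 + L2norm (cell L) g" using L2norm_nonneg[of "cell L" g] by simp
  fix x y :: "real^'d \<Rightarrow> 'b" and a b assume x: "x \<in> L2per L"
  show "\<bar>ip (cell L) x g / (1 + L2norm (cell L) g)\<bar> \<le> L2norm (cell L) x"
  proof -
    have "\<bar>ip (cell L) x g\<bar> \<le> L2norm (cell L) x * L2norm (cell L) g"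
      by (rule ip_Cauchy_Schwarz[OF L2per_L2[OF x] g cell_measurable])
    also have "\<dots> \<le> L2norm (cell L) x * (1 + L2norm (cell L) g)"
      by (intro mult_left_mono L2norm_nonneg) simp
    finally show ?thesis using pos by (simp add: divide_le_eq)
  qed
  assume y: "y \<in> L2per L"
  show "ip (cell L) (a *\<^sub>R x + b *\<^sub>R y) g / (1 + L2norm (cell L) g) =
      a * (ip (cell L) x g / (1 + L2norm (cell L) g)) + b * (ip (cell L) y g / (1 + L2norm (cell L) g))"
    by (simp add: ip_lincomb[OF L2per_L2[OF x] L2per_L2[OF y] g cell_measurable] add_divide_distrib)
qed

lemma stokes_velocity_in_V:
  assumes "stokes_velocity M F W T L G u0 u"
  shows "AE w in M. \<forall>t\<in>{0..T}. u t w \<in> V L"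
proof -
  have "AE w in M. (\<lambda>t. u t w) \<in> C_space T (V L) (Hnorm L 1)"
    using assms unfolding stokes_velocity_def bochner_L2_def strongly_measurable_def by blast
  then show ?thesis by eventually_elim (auto simp: C_space_def)
qed

lemma pressure_vanishes:
  fixes u :: "real \<Rightarrow> 'w \<Rightarrow> real^'d::finite \<Rightarrow> real^'d"
  assumes "0 < L" and F: "filtered_prob_space M F" and W: "wiener_process M F W"
    and A4: "A4 L G" and u0: "AE w in M. u0 w \<in> V L"
    and u: "AE w in M. \<forall>t\<in>{0..T}. u t w \<in> V L"
    and P: "stokes_pressure M F W T L G u0 u P" and t: "0 < t" "t \<le> T"
  shows "AE w in M. AE x in lborel. x \<in> cell L \<longrightarrow> P t w x = 0"
proof -
  obtain J where J: "ito_integral M F W (L2per L) (L2norm (cell L)) T (\<lambda>s w. G (u s w)) J"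
    and eq: "AE w in M. \<forall>t\<in>{0<..T}. P t w \<in> L2per L \<and>
          (\<forall>\<phi>\<in>Hper L 1.
             ip (cell L) (u t w) \<phi> + (LINT s:{0..t}|lborel. grad_ip L (u s w) \<phi>)
               - ip (cell L) (dvg L \<phi>) (P t w) =
             ip (cell L) (u0 w) \<phi> + ip (cell L) (J t w) \<phi>) \<and>
          (\<forall>q\<in>L2per L. ip (cell L) (dvg L (u t w)) q = 0)"
    using P unfolding stokes_pressure_def by blast
  have ito: "ito_integral_at M F W (L2per L) (L2norm (cell L)) t (\<lambda>s w. G (u s w)) (J t)"
    using J t by (auto simp: ito_integral_def)
  have GV: "G v \<in> V L" if "v \<in> V L" for v
    using A4 that by (auto simp: A4_def V_def)
  have "AE w in M. ip (cell L) (J t w) (gwave L n a) = 0" for n a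
  proof -
    let ?c = "1 + L2norm (cell L) (gwave L n a)"
    have pos: "0 < ?c" using L2norm_nonneg[of "cell L" "gwave L n a"] by simp
    have "AE w in M. ip (cell L) (J t w) (gwave L n a) / ?c = 0"
    proof (rule ito_integral_in_kernel[OF F W _ subspace_L2per contractive_functional_ip[OF gwave_in_L2] ito])
      show "AE w in M. \<forall>s\<in>{0..t}. G (u s w) \<in> L2per L \<and> ip (cell L) (G (u s w)) (gwave L n a) / ?c = 0"
        using u
      proof eventually_elim
        case (elim w)
        then show ?case
          using t V_no_gradient[OF \<open>0 < L\<close> GV] V_L2per[OF GV] by (auto simp: no_gradient_def)
      qed
    qed (use t in simp)
    then show ?thesis using pos by simp
  qed
  then have J0: "AE w in M. \<forall>n. \<forall>a\<in>{0, -pi/2}. ip (cell L) (J t w) (gwave L n a) = 0"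
    by (simp add: AE_all_countable)
  show ?thesis
    using eq J0 u0 u
  proof eventually_elim
    case (elim w)
    then have Pw: "P t w \<in> L2per L"
      and e: "\<And>\<phi>. \<phi> \<in> Hper L 1 \<Longrightarrow> ip (cell L) (u t w) \<phi> + (LINT s:{0..t}|lborel. grad_ip L (u s w) \<phi>)
               - ip (cell L) (dvg L \<phi>) (P t w) = ip (cell L) (u0 w) \<phi> + ip (cell L) (J t w) \<phi>"
      using t by auto
    show ?case
    proof (rule zero_if_divergence_tests_vanish[OF \<open>0 < L\<close> Pw])
      fix n :: "'d \<Rightarrow> int" and a :: real assume n: "n \<noteq> (\<lambda>i. 0)" and a: "a \<in> {0, -pi/2}"
      let ?g = "gwave L n a"
      have V: "ip (cell L) v ?g = 0" if "v \<in> V L" for v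
        using V_no_gradient[OF \<open>0 < L\<close> that] by (simp add: no_gradient_def)
      have "ip (cell L) (u t w) ?g = 0" "ip (cell L) (u0 w) ?g = 0"
        using V[OF bspec[OF elim(4), of t]] V[OF elim(3)] t by auto
      moreover have "ip (cell L) (J t w) ?g = 0" using elim(2) a by blast
      moreover have "(LINT s:{0..t}|lborel. grad_ip L (u s w) ?g) = (LINT s:{0..t}|lborel. 0)"
        using elim(4) t grad_ip_gwave[OF \<open>0 < L\<close> n]
        by (intro set_lebesgue_integral_cong) auto
      ultimately show "ip (cell L) (dvg L ?g) (P t w) = 0"
        using e[OF gwave_in_Hper1[OF \<open>0 < L\<close> n, of a]] by (simp add: set_lebesgue_integral_def)
    qed
  qed
qed

lemma discrete_pressure_vanishes:
  fixes G :: "('d::finite) field_map"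
  assumes "0 < L" and A2: "A2 L G DG D2G" and A4: "A4 L G"
    and v: "v \<in> V L" and v': "v' \<in> V L" and p: "p \<in> L2per L" and "k \<noteq> 0"
    and eq: "\<And>\<phi>. \<phi> \<in> Hper L 1 \<Longrightarrow>
      ip (cell L) (v' - v) \<phi> + k * grad_ip L v' \<phi> - k * ip (cell L) p (dvg L \<phi>) =
      ip (cell L) (c *\<^sub>R G v + (1 / 2) *\<^sub>R d *\<^sub>R DG v (G v)) \<phi>"
  shows "AE x in lborel. x \<in> cell L \<longrightarrow> p x = 0"
proof (rule zero_if_divergence_tests_vanish[OF \<open>0 < L\<close> p])
  fix n :: "'d \<Rightarrow> int" and a :: real assume n: "n \<noteq> (\<lambda>i. 0)"
  let ?g = "gwave L n a"
  have vH: "v \<in> Hper L 1" and GV: "G v \<in> V L" and GH: "G v \<in> Hper L 1"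
    using v A4 by (auto simp: V_def A4_def)
  note D = no_gradient_gateaux[OF \<open>0 < L\<close> A2 A4 vH GH]
  have "no_gradient L (1 *\<^sub>R v' + (-1) *\<^sub>R v)"
    by (intro no_gradient_lincomb L2per_L2 V_L2per V_no_gradient v v' \<open>0 < L\<close>)
  moreover have "no_gradient L (c *\<^sub>R G v + (1 / 2 * d) *\<^sub>R DG v (G v))"
    by (intro no_gradient_lincomb L2per_L2 V_L2per V_no_gradient GV D \<open>0 < L\<close>)
  ultimately have "k * ip (cell L) p (dvg L ?g) = 0"
    using eq[OF gwave_in_Hper1[OF \<open>0 < L\<close> n, of a]] grad_ip_gwave[OF \<open>0 < L\<close> n v', of a]
    by (simp add: no_gradient_def)
  then show "ip (cell L) (dvg L ?g) p = 0" using \<open>k \<noteq> 0\<close> by (simp add: ip_commute)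
qed

theorem theorem3p4:
  fixes M :: "'w measure"
    and F :: "real \<Rightarrow> 'w measure"
    and W :: "real \<Rightarrow> 'w \<Rightarrow> real"
    and T L :: real
    and G :: "('d::finite) field_map"
    and DG :: "(real^'d \<Rightarrow> real^'d) \<Rightarrow> 'd field_map"
    and D2G :: "(real^'d \<Rightarrow> real^'d) \<Rightarrow> (real^'d \<Rightarrow> real^'d) \<Rightarrow> 'd field_map"
    and u0 :: "'w \<Rightarrow> real^'d \<Rightarrow> real^'d"
    and u :: "real \<Rightarrow> 'w \<Rightarrow> real^'d \<Rightarrow> real^'d"
    and P :: "real \<Rightarrow> 'w \<Rightarrow> real^'d \<Rightarrow> real"
  assumes dim: "CARD('d) = 2 \<or> CARD('d) = 3"
    and "0 < L" and "0 < T"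
    and "filtered_prob_space M F"
    and "wiener_process M F W"
    and "\<forall>m\<in>{0, 1, 2}. \<forall>v\<in>Hper L m. G v \<in> Hper L m"
    and "A1 L G" and "A2 L G DG D2G" and "A3 L G DG" and "A4 L G"
    and "u0 \<in> bochner_L2 M (V L \<inter> Hdom (cell L) 2) (Hdom_norm (cell L) 2)"
    and "stokes_velocity M F W T L G u0 u"
    and "stokes_pressure M F W T L G u0 u P"
  shows "\<forall>\<epsilon>>0. \<exists>C>0. \<forall>K\<ge>1. \<forall>uh ph.
    milstein_scheme M W T L G DG u0 K uh ph \<longrightarrow>
    (let k = T / real K;
         pt = (\<lambda>n w. (1 / k) *\<^sub>R (P (real n * k) w - P (real (n - 1) * k) w))
     in (\<integral>\<^sup>+ w. ennreal (k * (\<Sum>n = 1..K. L2norm (cell L) (pt n w - ph n w))) \<partial>M)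
          \<le> ennreal (C * k powr (1 - \<epsilon>)))"
proof (intro allI impI exI[of _ "1::real"] conjI)
  fix \<epsilon> :: real and K :: nat and uh :: "nat \<Rightarrow> 'w \<Rightarrow> real^'d \<Rightarrow> real^'d" and ph :: "nat \<Rightarrow> 'w \<Rightarrow> real^'d \<Rightarrow> real"
  assume K: "1 \<le> K" and scheme: "milstein_scheme M W T L G DG u0 K uh ph"
  define k where "k = T / real K"
  have k: "0 < k" using K \<open>0 < T\<close> by (simp add: k_def)
  have u0: "AE w in M. u0 w \<in> V L"
  proof -
    have "AE w in M. u0 w \<in> V L \<inter> Hdom (cell L) 2"
      using assms(11) unfolding bochner_L2_def strongly_measurable_def by blast
    then show ?thesis by eventually_elim blast
  qed
  have P0: "AE w in M. AE x in lborel. x \<in> cell L \<longrightarrow> P 0 w x = 0"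
  proof -
    have "strongly_measurable M (F 0) (L2per L) (L2norm (cell L)) (P 0)"
      and P0: "AE w in M. L2norm (cell L) (P 0 w) = 0"
      using assms(13) \<open>0 < T\<close> unfolding stokes_pressure_def adapted_def by auto
    then have "AE w in M. P 0 w \<in> L2per L" by (simp add: strongly_measurable_def)
    with P0 show ?thesis
      by eventually_elim (rule AE_eq_0_if_L2norm_eq_0[OF L2per_L2 cell_measurable])
  qed
  have Pt: "AE w in M. AE x in lborel. x \<in> cell L \<longrightarrow> P (real n * k) w x = 0" if "n \<le> K" for n
  proof (cases "n = 0")
    case True then show ?thesis using P0 by simp
  next
    case False
    have "real n * k \<le> T" using that K \<open>0 < T\<close> by (simp add: k_def divide_le_eq mult.commute)
    then show ?thesis
      using pressure_vanishes[OF assms(2,4,5,10) u0 stokes_velocity_in_V[OF assms(12)] assms(13), of "real n * k"] False k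
      by simp
  qed
  have uh0: "uh 0 = u0"
    and uhV: "\<And>n. n < K \<Longrightarrow> AE w in M. uh (Suc n) w \<in> V L"
    and phL: "\<And>n. n < K \<Longrightarrow> AE w in M. ph (Suc n) w \<in> L2per L"
    and step: "\<And>n. n < K \<Longrightarrow> AE w in M. \<forall>\<phi>\<in>Hper L 1.
               ip (cell L) (uh (Suc n) w - uh n w) \<phi> + k * grad_ip L (uh (Suc n) w) \<phi>
                 - k * ip (cell L) (ph (Suc n) w) (dvg L \<phi>) =
               ip (cell L)
                 ((W (real (Suc n) * k) w - W (real n * k) w) *\<^sub>R G (uh n w)
                   + (1 / 2) *\<^sub>R ((W (real (Suc n) * k) w - W (real n * k) w)\<^sup>2 - k) *\<^sub>R DG (uh n w) (G (uh n w))) \<phi>"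
    using scheme unfolding milstein_scheme_def Let_def strongly_measurable_def k_def[symmetric]
    by auto
  have uhV': "AE w in M. uh n w \<in> V L" if "n < K" for n
    using that u0 uhV[of "n - 1"] uh0 by (cases n) auto
  have ph0: "AE w in M. AE x in lborel. x \<in> cell L \<longrightarrow> ph (Suc n) w x = 0" if "n < K" for n
    using uhV[OF that] uhV'[OF that] phL[OF that] step[OF that]
  proof eventually_elim
    case (elim w)
    show ?case
      by (rule discrete_pressure_vanishes[OF assms(2,8,10) elim(2,1,3) _ bspec[OF elim(4)]]) (use k in auto)
  qed
  have "AE w in M. L2norm (cell L) ((1 / k) *\<^sub>R (P (real n * k) w - P (real (n - 1) * k) w) - ph n w) = 0"
    if n: "n \<in> {1..K}" for n
  proof -
    have "AE w in M. AE x in lborel. x \<in> cell L \<longrightarrow> ph n w x = 0" using ph0[of "n - 1"] n by (cases n) auto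
    moreover have "AE w in M. AE x in lborel. x \<in> cell L \<longrightarrow> P (real n * k) w x = 0" using Pt n by simp
    moreover have "AE w in M. AE x in lborel. x \<in> cell L \<longrightarrow> P (real (n - 1) * k) w x = 0"
      by (rule Pt) (use n in auto)
    ultimately show ?thesis
    proof eventually_elim
      case (elim w)
      show ?case
        by (rule L2norm_eq_0, use elim in eventually_elim) (simp add: scaleR_fun_def)
    qed
  qed
  then have "AE w in M. \<forall>n\<in>{1..K}. L2norm (cell L) ((1 / k) *\<^sub>R (P (real n * k) w - P (real (n - 1) * k) w) - ph n w) = 0"
    by (intro AE_finite_allI) auto
  then have "(\<integral>\<^sup>+ w. ennreal (k * (\<Sum>n = 1..K. L2norm (cell L)
      ((1 / k) *\<^sub>R (P (real n * k) w - P (real (n - 1) * k) w) - ph n w))) \<partial>M) = (\<integral>\<^sup>+ w. 0 \<partial>M)"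
    by (intro nn_integral_cong_AE, elim eventually_mono) simp
  then show "let k = T / real K;
         pt = (\<lambda>n w. (1 / k) *\<^sub>R (P (real n * k) w - P (real (n - 1) * k) w))
     in (\<integral>\<^sup>+ w. ennreal (k * (\<Sum>n = 1..K. L2norm (cell L) (pt n w - ph n w))) \<partial>M)
          \<le> ennreal (1 * k powr (1 - \<epsilon>))"
    unfolding Let_def k_def[symmetric] by simp
qed simp

end
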